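(* Let $\theta\in(0,1/4)$, $c=10^{-12}\theta$ and $n,k$ positive integers with $2k<n$. Suppose $\mathcal{A}\subset\binom{[n]}{k}$ is intersecting. If $|\mathcal{A}|\ge\big(1-\frac{c(n-2k)}{n}\big)\binom{n-1}{k-1}$ then there is a star $\mathcal{S}$ with $E:=|\mathcal{A}\setminus\mathcal{S}|\le2\theta|\mathcal{S}|$. Furthermore, $|\mathcal{A}|\le|\mathcal{F}_E|$. In particular, if $E=\binom{u}{n-k-1}$ for a real number $u$ with $n-k-2\le u\le n-2$, then $|\mathcal{A}|\le\binom{n-1}{k-1}-\binom{u}{k-1}+E$.
   Context: A family is intersecting if any two of its members intersect. A star is a family $\mathcal{S}_i=\{A\in\binom{[n]}{k}: i\in A\}$ for some $i\in[n]$. $\binom{u}{j}=u(u-1)\cdots(u-j+1)/j!$ for real $u$. The colex order on $k$-sets is $A<B$ iff $\max(A\triangle B)\in B$. For an integer $0\le E\le\binom{n-2}{k-1}$, $\mathcal{F}_E=\mathcal{F}^{out}_E\cup\mathcal{F}^{in}_E$, where $\mathcal{F}^{out}_E$ consists of the final $E$ sets of $\binom{[n]\setminus\{1\}}{k}$ in colex order and $\mathcal{F}^{in}_E$ consists of all sets of $\mathcal{S}_1$ that intersect every set in $\mathcal{F}^{out}_E$.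
   Formalization: In the last clause the range n-k-2 ≤ u ≤ n-2 is replaced by n-k-2 < u ≤ n-2, because at u = n-k-2 (where E = 0) the claimed bound fails when 𝒜 is a full star. *)

theory Defs
  imports Complex_Main "HOL-Library.Ramsey"
begin

definition intersecting :: "nat set set \<Rightarrow> bool" where
  "intersecting \<A> \<longleftrightarrow> (\<forall>A\<in>\<A>. \<forall>B\<in>\<A>. A \<inter> B \<noteq> {})"

definition star :: "nat \<Rightarrow> nat \<Rightarrow> nat \<Rightarrow> nat set set" where
  "star n k i = {A \<in> nsets {1..n} k. i \<in> A}"

(* The conjunct A \<noteq> B is needed because Max {} is unspecified. *)
definition colex_less :: "nat set \<Rightarrow> nat set \<Rightarrow> bool" where
  "colex_less A B \<longleftrightarrow> A \<noteq> B \<and> Max (sym_diff A B) \<in> B"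

(* A set is among the final E sets of \<X> iff fewer than E sets of \<X> come after it.
   If E exceeds the size of a finite \<X>, the result is \<X> itself. *)
definition colex_final :: "nat \<Rightarrow> nat set set \<Rightarrow> nat set set" where
  "colex_final E \<X> = {A \<in> \<X>. card {B \<in> \<X>. colex_less A B} < E}"

definition F_out :: "nat \<Rightarrow> nat \<Rightarrow> nat \<Rightarrow> nat set set" where
  "F_out n k E = colex_final E (nsets ({1..n} - {1}) k)"

definition F_in :: "nat \<Rightarrow> nat \<Rightarrow> nat \<Rightarrow> nat set set" where
  "F_in n k E = {A \<in> star n k 1. \<forall>B\<in>F_out n k E. A \<inter> B \<noteq> {}}"

(* In the mathematical setting E is at most (n - 2) choose (k - 1); the definition is
   total in E, as customary. *)
definition F_family :: "nat \<Rightarrow> nat \<Rightarrow> nat \<Rightarrow> nat set set" where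
  "F_family n k E = F_out n k E \<union> F_in n k E"

end

theory Submission
  imports Defs "HOL-Library.Nat_Bijection" "HOL-Combinatorics.Permutations"
begin

text \<open>
  Write \<open>f\<close> for the indicator function of the family. No two members are disjoint, so the quadratic form
  of the Kneser graph vanishes at \<open>f\<close>. Its eigenvalues have absolute values decreasing in the degree, and
  the gap after degree one is proportional to \<open>(n - 2k)/n\<close>. As in Hoffman's bound, \<open>f\<close> is therefore close
  to an affine function \<open>m + (\<Sum>i\<in>A. \<phi> i)\<close>, with squared error at most \<open>c |\<A>|\<close>.

  Exchanging \<open>i\<close> for \<open>j\<close> in a set shows that every \<open>\<phi> i - \<phi> j\<close> is close to -1, 0 or 1. If all differences
  are close to 0, the affine function restricted to random cubes of transversals is a Rademacher sum with
  small coefficients, which cannot be close to a zero-one function unless its variance is tiny.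
  Otherwise some \<open>i\<close> lies above some \<open>l\<close>, and then almost all sets containing \<open>i\<close> and not \<open>l\<close> are in the family.
  Two such points above the same \<open>l\<close> would yield disjoint members, so there is a single point \<open>i\<close> above all others,
  and almost the whole star of \<open>i\<close> is contained in the family.

  Given the star of \<open>i\<close>, take complements in \<open>{1..n} - {i}\<close> of the \<open>E\<close> sets outside it. A member of the family
  in the star cannot lie in their shadow on level \<open>k - 1\<close>, whose size is bounded below by the Kruskal-Katona theorem and
  by Lovasz's version of it. Complementation reverses the colex order, so the complements of the final sets
  form an initial segment.
\<close>

section \<open>The Kruskal-Katona theorem\<close>

text \<open>The obstacle is uniformity in \<open>k\<close>. For \<open>n\<close> near
  \<open>2k\<close> the spectral gap closes, so the allowed deficit of the family is proportional to
  \<open>n - 2k\<close>, and this factor cancels. For small \<open>k / n\<close> the family is a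
  tiny portion of all k-sets, so the squared error has to be small against the size of the family,
  not against \<open>n choose k\<close>. The cube argument respects this: of two opposite
  transversals at most one is in the family, so the sum of their indicators is the square of their
  difference and is controlled by error and variance, with no density term. The constant 10^-12 has
  to beat one estimate above all: a coefficient difference at distance 10^-4 or more from -1, 0 and
  1 would cost 10^-8 on at least half of a star. For Kruskal-Katona, any family admits a lower bound
  on its shadow by its link and deletion at a point, and initial segments satisfy the reverse bound
  at their smallest point; induction compares the two.\<close>

definition shadow :: "'a set set \<Rightarrow> 'a set set" where
  "shadow F = {A - {x} | A x. A \<in> F \<and> x \<in> A}"

lemma shadowI: "A \<in> F \<Longrightarrow> x \<in> A \<Longrightarrow> A - {x} \<in> shadow F"
  by (auto simp: shadow_def)

lemma finite_shadow:
  assumes "finite F" "\<And>A. A \<in> F \<Longrightarrow> finite A"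
  shows "finite (shadow F)"
proof -
  have "shadow F = (\<Union>A\<in>F. (\<lambda>x. A - {x}) ` A)" by (auto simp: shadow_def)
  then show ?thesis using assms by auto
qed

lemma shadow_nsets: "F \<subseteq> nsets UNIV r \<Longrightarrow> shadow F \<subseteq> nsets UNIV (r - 1)"
  by (auto simp: shadow_def nsets_def)

section \<open>Compression towards a point\<close>

definition shift :: "'a \<Rightarrow> 'a \<Rightarrow> 'a set set \<Rightarrow> 'a set set" where
  "shift z j F = {B. if z \<in> B then B \<in> F \<or> transpose z j ` B \<in> F
                     else B \<in> F \<and> transpose z j ` B \<in> F}"

lemma transpose_image_mem [simp]:
  "z \<in> transpose z j ` B \<longleftrightarrow> j \<in> B" "j \<in> transpose z j ` B \<longleftrightarrow> z \<in> B"
proof -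
  have "x \<in> transpose z j ` B \<longleftrightarrow> transpose z j x \<in> B" for x
    by (metis image_eqI imageE transpose_involutory)
  then show "z \<in> transpose z j ` B \<longleftrightarrow> j \<in> B" "j \<in> transpose z j ` B \<longleftrightarrow> z \<in> B" by simp_all
qed

lemma transpose_image_twice [simp]: "transpose z j ` (transpose z j ` B) = B"
  by (simp add: image_image)

lemma transpose_image_id:
  "(z \<in> B \<longleftrightarrow> j \<in> B) \<Longrightarrow> transpose z j ` B = B"
  by (rule transpose_image_eq) 

lemma transpose_image_diff:
  "transpose z j ` (B - {x}) = transpose z j ` B - {transpose z j x}"
  by (simp add: image_set_diff)

text \<open>This map is the usual compression: \<open>j\<close> is replaced by \<open>z\<close>
  unless the result is already present. \<open>shift\<close> describes its image by membership: of
  two sets exchanged by the transposition, the one with \<open>z\<close> survives if either was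
  present, the one without \<open>z\<close> if both were.\<close>

lemma shift_bij:
  "bij_betw (\<lambda>A. if z \<notin> A \<and> transpose z j ` A \<notin> F then transpose z j ` A else A) F (shift z j F)"
  (is "bij_betw ?m _ _")
proof (rule bij_betw_imageI)
  show "inj_on ?m F"
  proof (rule inj_onI)
    fix A B assume "A \<in> F" "B \<in> F" "?m A = ?m B"
    then show "A = B" by (auto split: if_splits dest: arg_cong[of _ _ "(`) (transpose z j)"])
  qed
  show "?m ` F = shift z j F"
  proof safe
    fix A assume "A \<in> F" then show "?m A \<in> shift z j F"
      by (cases "j \<in> A") (auto simp: shift_def transpose_image_id)
  next
    fix B assume B: "B \<in> shift z j F"
    show "B \<in> ?m ` F"
    proof (cases "B \<in> F")
      case True
      with B show ?thesis by (intro image_eqI[of _ _ B]) (auto simp: shift_def)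
    next
      case False
      with B have "z \<in> B" "transpose z j ` B \<in> F" by (auto simp: shift_def split: if_splits)
      moreover have "j \<notin> B" using False calculation transpose_image_id by metis
      ultimately show ?thesis using False
        by (intro image_eqI[of _ _ "transpose z j ` B"]) auto
    qed
  qed
qed

lemma card_shift: "card (shift z j F) = card F"
  using bij_betw_same_card[OF shift_bij] by metis

lemma finite_shift: "finite F \<Longrightarrow> finite (shift z j F)"
  using bij_betw_finite[OF shift_bij] by metis

lemma shift_nsets: "F \<subseteq> nsets UNIV r \<Longrightarrow> shift z j F \<subseteq> nsets UNIV r"
proof
  fix B assume F: "F \<subseteq> nsets UNIV r" and "B \<in> shift z j F"
  then have "B \<in> F \<or> transpose z j ` B \<in> F" by (auto simp: shift_def split: if_splits)
  then show "B \<in> nsets UNIV r"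
    using F finite_image_iff[of "transpose z j" B] card_image[of "transpose z j" B]
    by (auto simp: nsets_def)
qed

text \<open>Deleting a point commutes with the transposition, so only the deletion of
  \<open>z\<close> itself is delicate, where both \<open>C\<close> and its image must be in the
  shadow. If \<open>j\<close> is absent, \<open>C\<close> is fixed by the transposition; if
  \<open>j\<close> is present, \<open>B\<close> is fixed and hence in \<open>F\<close>.\<close>

lemma shadow_shift: "shadow (shift z j F) \<subseteq> shift z j (shadow F)"
proof
  fix C assume "C \<in> shadow (shift z j F)"
  then obtain B x where B: "B \<in> shift z j F" "x \<in> B" "C = B - {x}" by (auto simp: shadow_def)
  have s: "transpose z j ` C = transpose z j ` B - {transpose z j x}"
    by (simp add: B transpose_image_diff)
  have 1: "B \<in> F \<Longrightarrow> C \<in> shadow F" using B by (auto intro: shadowI)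
  have 2: "transpose z j ` B \<in> F \<Longrightarrow> transpose z j ` C \<in> shadow F" 
    using B s by (auto intro!: shadowI)
  show "C \<in> shift z j (shadow F)"
  proof (cases "z \<in> C")
    case True
    then have "z \<in> B" using B by auto
    then show ?thesis using True B(1) 1 2 by (auto simp: shift_def)
  next
    case False
    show ?thesis
    proof (cases "z \<in> B")
      case F: False
      then show ?thesis using False B(1) 1 2 by (auto simp: shift_def)
    next
      case True
      then have x: "x = z" using False B by auto
      show ?thesis
      proof (cases "j \<in> B")
        case F: False
        then have "transpose z j ` C = C" using False B by (intro transpose_image_id) auto
        then show ?thesis using True False B(1) 1 2 by (auto simp: shift_def)
      next
        case T: True
        then have "transpose z j ` B = B" using True by (intro transpose_image_id) auto
        then show ?thesis using True False B(1) 1 2 by (auto simp: shift_def)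
      qed
    qed
  qed
qed

lemma card_shadow_shift:
  assumes "finite F" "F \<subseteq> nsets UNIV r"
  shows "card (shadow (shift z j F)) \<le> card (shadow F)"
proof -
  have "finite (shadow F)" using assms by (intro finite_shadow) (auto simp: nsets_def)
  then show ?thesis
    using card_mono[OF finite_shift shadow_shift] by (metis card_shift)
qed

text \<open>An extremal choice replaces iterated compression: among the families of this size with
  no larger shadow, take one with the most members through \<open>z\<close>. If an exchange failed,
  compressing once more would gain a member.\<close>

lemma stable_family_exists:
  fixes z :: 'a and F :: "'a set set"
  assumes "finite F" "F \<subseteq> nsets UNIV r"
  obtains G where "finite G" "G \<subseteq> nsets UNIV r" "card G = card F" "card (shadow G) \<le> card (shadow F)"
    "\<And>A j. A \<in> G \<Longrightarrow> j \<in> A \<Longrightarrow> z \<notin> A \<Longrightarrow> insert z (A - {j}) \<in> G"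
proof -
  define P where "P G \<longleftrightarrow> finite G \<and> G \<subseteq> nsets UNIV r \<and> card G = card F \<and> 
    card (shadow G) \<le> card (shadow F)" for G :: "'a set set"
  define w where "w G = card {A\<in>G. z \<in> A}" for G :: "'a set set"
  have "P F" using assms by (auto simp: P_def)
  moreover have "\<And>G. P G \<Longrightarrow> w G < Suc (card F)"
    using card_mono[of G "{A\<in>G. z \<in> A}" for G] by (fastforce simp: P_def w_def less_Suc_eq_le)
  ultimately obtain G where G: "P G" "\<And>H. P H \<Longrightarrow> w H \<le> w G"
    using ex_has_greatest_nat[of P F w "Suc (card F)"] by blast
  have "insert z (A - {j}) \<in> G" if A: "A \<in> G" "j \<in> A" "z \<notin> A" for A j
  proof (rule ccontr)
    assume n: "insert z (A - {j}) \<notin> G"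
    have t: "transpose z j ` A = insert z (A - {j})"
      using A by (auto simp: image_iff transpose_def)
    have "P (shift z j G)"
      using G(1) card_shadow_shift[of G r z j] shift_nsets[of G r z j] by (auto simp: P_def finite_shift card_shift)
    then have "w (shift z j G) \<le> w G" using G by blast
    moreover have "{A\<in>G. z \<in> A} \<subset> {A\<in>shift z j G. z \<in> A}"
    proof
      show "{A\<in>G. z \<in> A} \<subseteq> {A\<in>shift z j G. z \<in> A}" by (auto simp: shift_def)
      have "transpose z j ` A \<in> {A\<in>shift z j G. z \<in> A}" using A by (simp add: shift_def)
      moreover have "transpose z j ` A \<notin> {A\<in>G. z \<in> A}" using n t by simp
      ultimately show "{A\<in>G. z \<in> A} \<noteq> {A\<in>shift z j G. z \<in> A}" by blast
    qed
    then have "w G < w (shift z j G)" using G(1) unfolding w_def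
      by (intro psubset_card_mono) (auto simp: P_def finite_shift)
    ultimately show False by simp
  qed
  with G that show ?thesis by (auto simp: P_def)
qed

text \<open>Shifting towards a single point, after Frankl, reduces a family to its link and its deletion at this point.\<close>

lemma shadow_reduction:
  fixes F :: "'a set set"
  assumes F: "finite F" "F \<subseteq> nsets UNIV r" "F \<noteq> {}" and r: "0 < r"
  obtains F0 F1 :: "'a set set" where "finite F0" "finite F1" "F0 \<subseteq> nsets UNIV r" "F1 \<subseteq> nsets UNIV (r - 1)"
    "card F1 + card F0 = card F" "shadow F0 \<subseteq> F1"
    "card F1 + card (shadow F1) \<le> card (shadow F)" "F1 \<noteq> {}"
proof -
  fix z :: 'a
  obtain G where G: "finite G" "G \<subseteq> nsets UNIV r" "card G = card F" "card (shadow G) \<le> card (shadow F)"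
    and st: "\<And>A j. A \<in> G \<Longrightarrow> j \<in> A \<Longrightarrow> z \<notin> A \<Longrightarrow> insert z (A - {j}) \<in> G"
    using stable_family_exists[OF F(1,2)] by blast
  define F0 where "F0 = {A\<in>G. z \<notin> A}"
  define F1 where "F1 = (\<lambda>A. A - {z}) ` {A\<in>G. z \<in> A}"
  have c1: "card F1 = card {A\<in>G. z \<in> A}" unfolding F1_def
    by (intro card_image inj_onI) blast
  have fin: "finite F0" "finite F1" using G by (auto simp: F0_def F1_def)
  have n0: "F0 \<subseteq> nsets UNIV r" using G by (auto simp: F0_def)
  have n1: "F1 \<subseteq> nsets UNIV (r - 1)" using G by (auto simp: F1_def nsets_def)
  have "card G = card ({A\<in>G. z \<in> A} \<union> F0)" by (rule arg_cong[of _ _ card]) (auto simp: F0_def)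
  also have "\<dots> = card {A\<in>G. z \<in> A} + card F0" using G by (subst card_Un_disjoint) (auto simp: F0_def)
  finally have card: "card F1 + card F0 = card F" using c1 G by simp
  have sub: "shadow F0 \<subseteq> F1"
  proof
    fix C assume "C \<in> shadow F0"
    then obtain A x where A: "A \<in> G" "z \<notin> A" "x \<in> A" "C = A - {x}" by (auto simp: F0_def shadow_def)
    then show "C \<in> F1" unfolding F1_def by (intro image_eqI[OF _ CollectI, of _ _ "insert z (A - {x})"]) (auto intro: st)
  qed
  \<comment> \<open>Deleting \<open>z\<close> from the members through \<open>z\<close> gives
    \<open>F1\<close>; deleting another point gives \<open>shadow F1\<close> with \<open>z\<close>
    added. The two kinds are told apart by \<open>z\<close>.\<close>
  have "F1 \<union> insert z ` shadow F1 \<subseteq> shadow G"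
  proof safe
    fix A assume "A \<in> F1" then show "A \<in> shadow G" by (auto simp: F1_def intro: shadowI)
  next
    fix A assume "A \<in> shadow F1"
    then obtain B x where B: "B \<in> G" "z \<in> B" "x \<in> B" "x \<noteq> z" "A = B - {z} - {x}" by (auto simp: F1_def shadow_def)
    then have "insert z A = B - {x}" by auto
    then show "insert z A \<in> shadow G" using B by (auto intro: shadowI)
  qed
  moreover have fs: "finite (shadow F1)" "finite (shadow G)"
    using fin n1 G by (auto intro!: finite_shadow simp: nsets_def)
  moreover have "card (F1 \<union> insert z ` shadow F1) = card F1 + card (shadow F1)"
  proof -
    have "inj_on (insert z) (shadow F1)"
      by (intro inj_onI) (auto simp: shadow_def F1_def)
    moreover have "F1 \<inter> insert z ` shadow F1 = {}" by (auto simp: F1_def)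
    ultimately show ?thesis using fin fs by (simp add: card_Un_disjoint card_image)
  qed
  ultimately have sh: "card F1 + card (shadow F1) \<le> card (shadow F)"
    using G(4) by (metis card_mono order_trans)
  have "G \<noteq> {}" using F G by auto
  then obtain A where A: "A \<in> G" by auto
  \<comment> \<open>This is what makes \<open>F0\<close> strictly smaller than \<open>F\<close> in
    the later inductions.\<close>
  have "F1 \<noteq> {}"
  proof (cases "z \<in> A")
    case True with A show ?thesis by (auto simp: F1_def)
  next
    case False
    have "card A = r" using A G by (auto simp: nsets_def)
    then obtain j where "j \<in> A" using r by fastforce
    then have "A - {j} \<in> shadow F0" using A False by (intro shadowI) (auto simp: F0_def)
    then show ?thesis using sub by auto
  qed
  then show ?thesis using that fin n0 n1 card sub sh by blast
qed

section \<open>Initial segments of the colex order\<close>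

definition colex_initial :: "nat \<Rightarrow> nat set set \<Rightarrow> bool" where
  "colex_initial r I \<longleftrightarrow> finite I \<and> I \<subseteq> nsets UNIV r \<and>
     (\<forall>A\<in>I. \<forall>B\<in>nsets UNIV r. set_encode B < set_encode A \<longrightarrow> B \<in> I)"

lemma set_encode_lt_pow: 
  assumes "A \<subseteq> {..<m}" shows "set_encode A < 2 ^ m"
proof -
  have "set_encode A \<le> (\<Sum>i\<in>{..<m}. 2 ^ i)" unfolding set_encode_def using assms by (intro sum_mono2) auto
  also have "\<dots> = 2 ^ m - 1" by (simp add: lessThan_atLeast0 sum_power2)
  finally show ?thesis by (simp add: le_less_trans)
qed

text \<open>The binary code turns the colex order into the order of the naturals: the largest
  differing element \<open>y\<close> contributes \<open>2 ^ y\<close>, more than all smaller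
  elements together.\<close>

lemma set_encode_less:
  assumes fin: "finite A" "finite B" and y: "y \<in> B" "y \<notin> A" and ag: "\<And>x. y < x \<Longrightarrow> x \<in> A \<longleftrightarrow> x \<in> B"
  shows "set_encode A < set_encode B"
proof -
  have A: "A = (A \<inter> {..<y}) \<union> (A \<inter> {y<..})" using y by (auto simp: not_less_iff_gr_or_eq)
  have "set_encode A = set_encode (A \<inter> {..<y}) + set_encode (A \<inter> {y<..})"
    unfolding set_encode_def by (subst A, rule sum.union_disjoint) (auto simp: fin)
  also have "\<dots> < 2 ^ y + set_encode (A \<inter> {y<..})" by (simp add: set_encode_lt_pow)
  also have "A \<inter> {y<..} = B \<inter> {y<..}" using ag by auto
  also have "2 ^ y + set_encode (B \<inter> {y<..}) = set_encode (insert y (B \<inter> {y<..}))"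
    by (simp add: fin)
  also have "\<dots> \<le> set_encode B" unfolding set_encode_def using fin y by (intro sum_mono2) auto
  finally show ?thesis .
qed

lemma colex_cases:
  fixes A B :: "nat set"
  assumes "finite A" "finite B" "A \<noteq> B"
  obtains y where "y \<in> sym_diff A B" "\<And>x. y < x \<Longrightarrow> x \<in> A \<longleftrightarrow> x \<in> B" "y = Max (sym_diff A B)"
proof -
  have f: "finite (sym_diff A B)" "sym_diff A B \<noteq> {}" using assms by auto
  show ?thesis
    by (rule that[OF Max_in[OF f]]) (use Max_ge[OF f(1)] in \<open>auto simp: not_less[symmetric]\<close>)
qed

lemma set_encode_lessE:
  assumes "finite A" "finite B" "set_encode A < set_encode B"
  obtains y where "y \<in> B" "y \<notin> A" "\<And>x. y < x \<Longrightarrow> x \<in> A \<longleftrightarrow> x \<in> B"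
proof -
  have "A \<noteq> B" using assms by auto
  then obtain y where y: "y \<in> sym_diff A B" "\<And>x. y < x \<Longrightarrow> x \<in> A \<longleftrightarrow> x \<in> B"
    using colex_cases assms by metis
  have "y \<notin> A"
    using y set_encode_less[of B A y] assms by (metis DiffD2 Un_iff less_asym)
  with y that show ?thesis by blast
qed

lemma colex_less_iff:
  assumes "finite A" "finite B"
  shows "colex_less A B \<longleftrightarrow> set_encode A < set_encode B"
proof (cases "A = B")
  case False
  obtain y where y: "y \<in> sym_diff A B" "\<And>x. y < x \<Longrightarrow> x \<in> A \<longleftrightarrow> x \<in> B" "y = Max (sym_diff A B)"
    using colex_cases assms False by metis
  show ?thesis
  proof (cases "y \<in> B")
    case True
    with y have "set_encode A < set_encode B" by (intro set_encode_less[of A B y] assms) auto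
    then show ?thesis using False True y(3) by (simp add: colex_less_def)
  next
    case n: False
    with y have "set_encode B < set_encode A" by (intro set_encode_less[of B A y] assms) auto
    then show ?thesis using False n y(3) by (simp add: colex_less_def)
  qed
qed (simp add: colex_less_def)

text \<open>Adding the least missing element is the cheapest way to enlarge \<open>C\<close>, so it
  stays below any enlargement of the larger set \<open>A\<close>. If \<open>z\<close> still decides,
  or \<open>x\<close> lies above it, this is immediate; only \<open>y = z\<close> needs a
  count.\<close>

lemma set_encode_insert_least_le:
  assumes fin: "finite A" "finite C" "card A = card C" and lt: "set_encode C < set_encode A"
    and y: "y \<notin> C" "\<And>i. i < y \<Longrightarrow> i \<in> C" and x: "x \<notin> A"
  shows "set_encode (insert y C) \<le> set_encode (insert x A)"
proof -
  obtain z where z: "z \<in> A" "z \<notin> C" and ag: "\<And>i. z < i \<Longrightarrow> i \<in> C \<longleftrightarrow> i \<in> A"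
    using set_encode_lessE[OF fin(2,1) lt] by metis
  have yz: "y \<le> z" using y z by (meson not_le)
  have xz: "x \<noteq> z" using x z by auto
  show ?thesis
  proof (cases "z < x")
    case True
    then show ?thesis using fin x ag yz
      by (intro less_imp_le set_encode_less[of _ _ x]) auto
  next
    case False
    then have x_z: "x < z" using xz by auto
    show ?thesis
    proof (cases "y = z")
      case False
      then show ?thesis using fin x x_z ag yz z
        by (intro less_imp_le set_encode_less[of _ _ z]) auto
    next
      case True
      have C: "C = {..<z} \<union> (C \<inter> {z<..})" using y True by (auto simp: not_less_iff_gr_or_eq)
      have cC: "card C = z + card (C \<inter> {z<..})" by (subst C, subst card_Un_disjoint) (auto simp: fin)
      have A: "A = (A \<inter> {..<z}) \<union> insert z (C \<inter> {z<..})"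
      proof (rule set_eqI)
        fix i show "i \<in> A \<longleftrightarrow> i \<in> (A \<inter> {..<z}) \<union> insert z (C \<inter> {z<..})"
          using z ag by (cases i z rule: linorder_cases) auto
      qed
      have cA: "card A = card (A \<inter> {..<z}) + Suc (card (C \<inter> {z<..}))"
        by (subst A, subst card_Un_disjoint) (auto simp: fin)
      \<comment> \<open>\<open>C\<close> is full below \<open>z\<close>, so counting leaves
        \<open>A\<close> exactly one gap there, which \<open>x\<close> must fill; the two enlarged
        sets coincide.\<close>
      have "card (insert x (A \<inter> {..<z})) = z" using cA cC fin x by simp
      then have "insert x (A \<inter> {..<z}) = {..<z}" using x_z
        by (intro card_subset_eq) auto
      then have "insert x A = {..<z} \<union> insert z (C \<inter> {z<..})" by (subst A) blast
      also have "\<dots> = insert y C" by (subst (2) C) (auto simp: True)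
      finally show ?thesis by simp
    qed
  qed
qed

lemma least_missing:
  assumes "finite (C :: nat set)"
  obtains y where "y \<notin> C" "\<And>i. i < y \<Longrightarrow> i \<in> C"
proof -
  obtain y where "y \<notin> C" using assms ex_new_if_finite infinite_UNIV_nat by blast
  then show ?thesis using that[of "LEAST y. y \<notin> C"] LeastI[of "\<lambda>y. y \<notin> C"] not_less_Least by blast
qed

lemma colex_initial_le:
  assumes "colex_initial r I" "A \<in> I" "B \<in> nsets UNIV r" "set_encode B \<le> set_encode A"
  shows "B \<in> I"
proof (cases "set_encode B = set_encode A")
  case True
  then have "B = A" using assms set_encode_eq[of B A] by (auto simp: colex_initial_def nsets_def)
  then show ?thesis using assms by simp
qed (use assms in \<open>auto simp: colex_initial_def\<close>)

lemma colex_initial_shadow: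
  assumes I: "colex_initial r I"
  shows "colex_initial (r - 1) (shadow I)"
proof -
  have fin: "finite (shadow I)" using I by (intro finite_shadow) (auto simp: colex_initial_def nsets_def)
  have ns: "shadow I \<subseteq> nsets UNIV (r - 1)" using I by (intro shadow_nsets) (auto simp: colex_initial_def)
  have "C \<in> shadow I" if A: "A \<in> shadow I" and C: "C \<in> nsets UNIV (r - 1)" and lt: "set_encode C < set_encode A" for A C
  proof -
    obtain x B where B: "B \<in> I" "x \<in> B" "A = B - {x}" using A by (auto simp: shadow_def)
    have rB: "finite B" "card B = r" using B I by (auto simp: colex_initial_def nsets_def)
    then have r: "0 < r" using B by auto
    obtain y where y: "y \<notin> C" "\<And>i. i < y \<Longrightarrow> i \<in> C" using least_missing C by (auto simp: nsets_def)
    have "set_encode (insert y C) \<le> set_encode (insert x A)"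
      using y lt B rB C by (intro set_encode_insert_least_le) (auto simp: nsets_def)
    moreover have "insert x A = B" using B by auto
    moreover have "insert y C \<in> nsets UNIV r" using C y r by (auto simp: nsets_def)
    ultimately have "insert y C \<in> I" using colex_initial_le[OF I B(1)] by simp
    then have "insert y C - {y} \<in> shadow I" by (intro shadowI) auto
    then show ?thesis using y by simp
  qed
  then show ?thesis using fin ns by (auto simp: colex_initial_def)
qed

lemma colex_initial_insert_next:
  assumes I: "colex_initial r I" and r: "0 < r"
  obtains B where "B \<in> nsets UNIV r" "B \<notin> I" "colex_initial r (insert B I)"
proof -
  have "finite (\<Union>I)" using I by (auto simp: colex_initial_def nsets_def)
  then obtain m where m: "\<And>i. i \<in> \<Union>I \<Longrightarrow> i < m" using finite_nat_set_iff_bounded by meson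
  \<comment> \<open>An r-set above all members shows that some r-set lies outside \<open>I\<close>;
    the one of least code is then the next set.\<close>
  have "{m..<m + r} \<notin> I"
  proof
    assume "{m..<m + r} \<in> I"
    then have "m \<in> \<Union>I" using r by (intro UnionI[of "{m..<m + r}"]) auto
    then show False using m by blast
  qed
  then have "{m..<m + r} \<in> nsets UNIV r \<and> {m..<m + r} \<notin> I" by (auto simp: nsets_def)
  then obtain B where B: "B \<in> nsets UNIV r" "B \<notin> I" 
    and least: "\<And>A. A \<in> nsets UNIV r \<and> A \<notin> I \<Longrightarrow> set_encode B \<le> set_encode A"
    using ex_has_least_nat[of "\<lambda>B. B \<in> nsets UNIV r \<and> B \<notin> I" _ set_encode] by blast
  have "\<And>A. A \<in> nsets UNIV r \<Longrightarrow> set_encode A < set_encode B \<Longrightarrow> A \<in> I"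
    using least by (meson not_le)
  then have "colex_initial r (insert B I)" using I B by (auto simp: colex_initial_def)
  then show thesis using that B by blast
qed


text \<open>Deleting the minimum of \<open>B\<close> reduces this to sets of equal size. The
  reduction fails only if that minimum is the deciding element \<open>z\<close>; then the rest of
  \<open>B\<close> equals \<open>A\<close>, and \<open>y\<close> is at most
  \<open>z\<close>.\<close>

lemma set_encode_insert_least_le_next:
  assumes fin: "finite A" "finite B" "card B = Suc (card A)" and lt: "set_encode A < set_encode B"
    and y: "y \<notin> A" "\<And>i. i < y \<Longrightarrow> i \<in> A"
  shows "set_encode (insert y A) \<le> set_encode B"
proof -
  obtain z where z: "z \<in> B" "z \<notin> A" and ag: "\<And>i. z < i \<Longrightarrow> i \<in> A \<longleftrightarrow> i \<in> B"
    using set_encode_lessE[OF fin(1,2) lt] by metis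
  define x where "x = Min B"
  have x: "x \<in> B" "\<And>i. i \<in> B \<Longrightarrow> x \<le> i" using Min_in[OF fin(2)] Min_le[OF fin(2)] z by (auto simp: x_def)
  have B: "B = insert x (B - {x})" using x by auto
  have c: "card (B - {x}) = card A" using fin x by simp
  show ?thesis
  proof (cases "z = x")
    case True
    have "B - {x} \<subseteq> A" using ag x True by (metis DiffE insertI1 le_neq_implies_less subsetI)
    then have A: "B - {x} = A" using c fin by (intro card_subset_eq) auto
    have "x \<notin> A" using z True by simp
    moreover have "y \<le> x" using y \<open>x \<notin> A\<close> by (meson not_le)
    ultimately show ?thesis using y fin B A by (metis add_right_mono one_le_numeral power_increasing set_encode_insert)
  next
    case False
    have "set_encode A < set_encode (B - {x})"
    proof (rule set_encode_less[of _ _ z])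
      show "i \<in> A \<longleftrightarrow> i \<in> B - {x}" if "z < i" for i
        using ag[OF that] x(2)[OF z(1)] that by auto
    qed (use fin z False in auto)
    then have "set_encode (insert y A) \<le> set_encode (insert x (B - {x}))"
      using fin c y by (intro set_encode_insert_least_le) auto
    then show ?thesis using B by simp
  qed
qed

lemma set_encode_Suc:
  assumes "finite A"
  shows "set_encode (Suc ` A) = 2 * set_encode A"
  unfolding set_encode_def by (simp add: sum.reindex sum_distrib_left)

lemma set_encode_insert_0_Suc:
  assumes "finite A"
  shows "set_encode (insert 0 (Suc ` A)) = 2 * set_encode A + 1"
  using assms by (simp add: set_encode_Suc)

lemma nat_set_cases_0:
  obtains (notin) B where "A = Suc ` B" | (isin) B where "A = insert 0 (Suc ` B)"
proof (cases "0 \<in> A")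
  case True
  have "A = insert 0 (Suc ` (Suc -` A))"
  proof (rule set_eqI)
    fix x show "x \<in> A \<longleftrightarrow> x \<in> insert 0 (Suc ` (Suc -` A))" using True by (cases x) auto
  qed
  then show ?thesis using isin by blast
next
  case False
  have "A = Suc ` (Suc -` A)"
  proof (rule set_eqI)
    fix x show "x \<in> A \<longleftrightarrow> x \<in> Suc ` (Suc -` A)" using False by (cases x) auto
  qed
  then show ?thesis using notin by blast
qed

text \<open>Splitting at the smallest point 0 and renumbering gives codes \<open>2 * a\<close>
  without 0 and \<open>2 * a + 1\<close> with 0, so both parts stay initial. Since \<open>I\<close>
  is closed under exchanging a point for 0, its shadow obeys the reverse of the inequality in
  \<open>shadow_reduction\<close>. The last clause rules out a \<open>J1\<close> that is too large
  compared with \<open>J0\<close>.\<close>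

lemma colex_initial_split:
  assumes I: "colex_initial r I" and r: "0 < r"
  obtains J0 J1 where "colex_initial r J0" "colex_initial (r - 1) J1"
    "card I = card J0 + card J1" "card (shadow I) \<le> card J1 + card (shadow J1)"
    "\<And>J. colex_initial r J \<Longrightarrow> card J0 < card J \<Longrightarrow> J0 \<subseteq> J \<Longrightarrow> J1 \<subseteq> shadow J"
proof -
  define J0 where "J0 = {A. Suc ` A \<in> I}"
  define J1 where "J1 = {A. insert 0 (Suc ` A) \<in> I}"
  have ns: "A \<in> nsets UNIV r" if "A \<in> I" for A using that I by (auto simp: colex_initial_def)
  have inj1: "inj (\<lambda>A. insert 0 (Suc ` A))"
    by (rule injI) (metis (no_types, lifting) Diff_insert_absorb imageE inj_Suc inj_image_eq_iff nat.distinct(1))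
  have inj0: "inj ((`) Suc)" by (simp add: inj_image_eq_iff inj_def)
  have fin: "finite J0" "finite J1" unfolding J0_def J1_def
    using I finite_vimageI[OF _ inj0, of I] finite_vimageI[OF _ inj1, of I] by (auto simp: vimage_def colex_initial_def)
  have "Suc ` A \<in> nsets UNIV r \<longleftrightarrow> A \<in> nsets UNIV r" for A
    by (auto simp: nsets_def card_image finite_image_iff)
  note n0 = this
  have "insert 0 (Suc ` A) \<in> nsets UNIV r \<longleftrightarrow> A \<in> nsets UNIV (r - 1)" for A
    using r by (cases "finite A") (auto simp: nsets_def card_image finite_image_iff)
  note n1 = this
  have i0: "colex_initial r J0" unfolding colex_initial_def
  proof (intro conjI ballI impI subsetI)
    fix A assume "A \<in> J0" then show "A \<in> nsets UNIV r" using ns n0 by (auto simp: J0_def)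
  next
    fix A B assume A: "A \<in> J0" and B: "B \<in> nsets UNIV r" "set_encode B < set_encode A"
    then have "finite A" "finite B" using ns n0 by (auto simp: J0_def nsets_def)
    then show "B \<in> J0" using A B n0[of B] colex_initial_le[OF I, of "Suc ` A" "Suc ` B"]
      by (simp add: J0_def set_encode_Suc)
  qed (fact fin)
  have i1: "colex_initial (r - 1) J1" unfolding colex_initial_def
  proof (intro conjI ballI impI subsetI)
    fix A assume "A \<in> J1" then show "A \<in> nsets UNIV (r - 1)" using ns n1 by (auto simp: J1_def)
  next
    fix A B assume A: "A \<in> J1" and B: "B \<in> nsets UNIV (r - 1)" "set_encode B < set_encode A"
    have "A \<in> nsets UNIV (r - 1)" using A ns n1 by (auto simp: J1_def)
    then have "finite A" "finite B" using B by (auto simp: nsets_def)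
    then show "B \<in> J1" using A B n1[of B] colex_initial_le[OF I, of "insert 0 (Suc ` A)" "insert 0 (Suc ` B)"]
      by (simp add: J1_def set_encode_insert_0_Suc del: set_encode_insert)
  qed (fact fin)
  have "I = (`) Suc ` J0 \<union> (\<lambda>A. insert 0 (Suc ` A)) ` J1"
  proof (intro set_eqI iffI)
    fix A assume "A \<in> I" then show "A \<in> (`) Suc ` J0 \<union> (\<lambda>A. insert 0 (Suc ` A)) ` J1"
      by (cases A rule: nat_set_cases_0) (auto simp: J0_def J1_def)
  qed (auto simp: J0_def J1_def)
  then have "card I = card ((`) Suc ` J0 \<union> (\<lambda>A. insert 0 (Suc ` A)) ` J1)" by simp
  also have "\<dots> = card ((`) Suc ` J0) + card ((\<lambda>A. insert 0 (Suc ` A)) ` J1)"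
    by (rule card_Un_disjoint) (auto simp: fin)
  also have "\<dots> = card J0 + card J1"
    using inj0 inj1 by (metis card_image inj_on_subset subset_UNIV)
  finally have cI: "card I = card J0 + card J1" .
  have nJ: "A \<in> nsets UNIV (r - 1)" if "A \<in> J1" for A using that ns n1 by (auto simp: J1_def)
  then have fJ: "finite A" if "A \<in> J1" for A using that by (auto simp: nsets_def)
  have sh: "shadow I \<subseteq> (`) Suc ` J1 \<union> (\<lambda>A. insert 0 (Suc ` A)) ` shadow J1"
  proof
    fix C assume "C \<in> shadow I"
    then obtain A x where A: "A \<in> I" "x \<in> A" "C = A - {x}" by (auto simp: shadow_def)
    have fA: "finite A" "card A = r" using ns A by (auto simp: nsets_def)
    show "C \<in> (`) Suc ` J1 \<union> (\<lambda>A. insert 0 (Suc ` A)) ` shadow J1"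
    proof (cases A rule: nat_set_cases_0)
      case (notin B)
      then obtain b where b: "b \<in> B" "x = Suc b" using A by auto
      have C: "C = Suc ` (B - {b})" using A notin b by auto
      have "set_encode (insert 0 (Suc ` (B - {b}))) \<le> set_encode A"
        using fA notin b A by (intro less_imp_le set_encode_less[of _ _ x]) (auto simp: finite_image_iff)
      moreover have "insert 0 (Suc ` (B - {b})) \<in> nsets UNIV r"
        unfolding n1 using fA notin b by (auto simp: nsets_def card_image finite_image_iff)
      ultimately have "B - {b} \<in> J1" using colex_initial_le[OF I A(1)] by (simp add: J1_def del: set_encode_insert)
      then show ?thesis using C by auto
    next
      case (isin B)
      show ?thesis
      proof (cases x)
        case 0
        then have "C = Suc ` B" using A isin by auto
        then show ?thesis using A isin by (auto simp: J1_def)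
      next
        case (Suc b)
        then have "C = insert 0 (Suc ` (B - {b}))" "b \<in> B" "B \<in> J1" using A isin by (auto simp: J1_def)
        then show ?thesis by (auto intro: shadowI)
      qed
    qed
  qed
  have fs: "finite (shadow J1)" using fin fJ by (intro finite_shadow) auto
  have "card (shadow I) \<le> card ((`) Suc ` J1 \<union> (\<lambda>A. insert 0 (Suc ` A)) ` shadow J1)"
    using sh fs fin by (intro card_mono) auto
  also have "\<dots> \<le> card ((`) Suc ` J1) + card ((\<lambda>A. insert 0 (Suc ` A)) ` shadow J1)" by (rule card_Un_le)
  also have "\<dots> \<le> card J1 + card (shadow J1)" using fs fin by (intro add_mono card_image_le)
  finally have csh: "card (shadow I) \<le> card J1 + card (shadow J1)" .
  have "J1 \<subseteq> shadow J" if J: "colex_initial r J" "card J0 < card J" "J0 \<subseteq> J" for J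
  proof
    fix A assume A: "A \<in> J1"
    obtain B where B: "B \<in> J" "B \<notin> J0" using J by (metis less_irrefl subsetI subset_antisym)
    have fB: "finite B" "card B = r" using J(1) B by (auto simp: colex_initial_def nsets_def)
    have fA: "finite A" "Suc (card A) = r" using nJ[OF A] r by (auto simp: nsets_def)
    \<comment> \<open>The codes compared are \<open>2 * b\<close> and \<open>2 * a + 1\<close>, so
      the comparison descends to the strict one between \<open>a\<close> and
      \<open>b\<close>.\<close>
    have "\<not> set_encode (Suc ` B) \<le> set_encode (insert 0 (Suc ` A))"
      using colex_initial_le[OF I, of "insert 0 (Suc ` A)" "Suc ` B"] A B fB n0[of B] 
      by (auto simp: J1_def J0_def nsets_def)
    then have lt: "set_encode A < set_encode B" using fA fB 
      by (simp add: set_encode_insert_0_Suc set_encode_Suc del: set_encode_insert)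
    obtain y where y: "y \<notin> A" "\<And>i. i < y \<Longrightarrow> i \<in> A" using least_missing fA by metis
    have "set_encode (insert y A) \<le> set_encode B"
      using fA fB lt y by (intro set_encode_insert_least_le_next) auto
    moreover have "insert y A \<in> nsets UNIV r" using fA y by (auto simp: nsets_def)
    ultimately have "insert y A \<in> J" using colex_initial_le[OF J(1) B(1)] by simp
    then have "insert y A - {y} \<in> shadow J" by (intro shadowI) auto
    then show "A \<in> shadow J" using y by simp
  qed
  with that i0 i1 cI csh show ?thesis by blast
qed

text \<open>If \<open>J1\<close> is no larger than \<open>F1\<close>, induction on the links
  finishes. Otherwise \<open>J0\<close> is smaller than \<open>F0\<close>. Enlarged by the next set,
  it has a shadow containing \<open>J1\<close>; by induction this shadow is no larger than that of
  \<open>F0\<close>, which lies in \<open>F1\<close>, a contradiction.\<close>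

theorem kruskal_katona:
  fixes F :: "'a set set"
  assumes "finite F" "F \<subseteq> nsets UNIV r" "colex_initial r I" "card I \<le> card F"
  shows "card (shadow I) \<le> card (shadow F)"
  using assms
proof (induction "r + card F" arbitrary: r F I rule: less_induct)
  case less
  show ?case
  proof (cases "F = {} \<or> r = 0")
    case True
    then have "shadow I = {}"
    proof
      assume "r = 0"
      then show ?thesis using less.prems by (auto simp: colex_initial_def nsets_def shadow_def)
    qed (use less.prems in \<open>auto simp: colex_initial_def shadow_def\<close>)
    then show ?thesis by simp
  next
    case False
    then have r: "0 < r" "F \<noteq> {}" by auto
    obtain F0 F1 :: "'a set set" where F: "finite F0" "finite F1" "F0 \<subseteq> nsets UNIV r" "F1 \<subseteq> nsets UNIV (r - 1)"
      "card F1 + card F0 = card F" "shadow F0 \<subseteq> F1"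
      "card F1 + card (shadow F1) \<le> card (shadow F)" "F1 \<noteq> {}"
      using shadow_reduction[OF less.prems(1,2) r(2,1)] by metis
    obtain J0 J1 where J: "colex_initial r J0" "colex_initial (r - 1) J1"
      "card I = card J0 + card J1" "card (shadow I) \<le> card J1 + card (shadow J1)"
      "\<And>J. colex_initial r J \<Longrightarrow> card J0 < card J \<Longrightarrow> J0 \<subseteq> J \<Longrightarrow> J1 \<subseteq> shadow J"
      using colex_initial_split[OF less.prems(3) r(1)] by metis
    have c1: "0 < card F1" using F by (simp add: card_gt_0_iff)
    have "card J1 \<le> card F1"
    proof (rule ccontr)
      assume n: "\<not> card J1 \<le> card F1"
      then have c0: "Suc (card J0) \<le> card F0" using F(5) J(3) less.prems(4) by simp
      obtain B where B: "B \<notin> J0" "colex_initial r (insert B J0)"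
        using colex_initial_insert_next[OF J(1) r(1)] by metis
      have cB: "card (insert B J0) = Suc (card J0)" using B J(1) by (simp add: colex_initial_def)
      have "card (shadow (insert B J0)) \<le> card (shadow F0)"
        using less.hyps[OF _ F(1,3) B(2)] c0 c1 F(5) cB by simp
      moreover have "card J1 \<le> card (shadow (insert B J0))"
        using J(5)[OF B(2)] cB colex_initial_shadow[OF B(2)] by (auto simp: colex_initial_def intro!: card_mono)
      moreover have "card (shadow F0) \<le> card F1" using F by (intro card_mono)
      ultimately show False using n by simp
    qed
    moreover from this have "card (shadow J1) \<le> card (shadow F1)"
      using less.hyps[OF _ F(2,4) J(2)] F(5) r by simp
    ultimately show ?thesis using J(4) F(7) by simp
  qed
qed

section \<open>Lovasz's bound with a real parameter\<close>

lemma gbinomial_Suc_Suc': "(x :: real) gchoose Suc r = ((x - 1) gchoose r) + ((x - 1) gchoose Suc r)"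
  using gbinomial_Suc_Suc[of "x - 1" r] by (simp add: add.commute)

lemma gbinomial_nonneg_real: "real r - 1 \<le> x \<Longrightarrow> 0 \<le> x gchoose r"
  by (auto simp: gbinomial_prod_rev intro!: divide_nonneg_nonneg prod_nonneg)

lemma gbinomial_mono_real: "real r - 1 \<le> x \<Longrightarrow> x \<le> y \<Longrightarrow> x gchoose r \<le> y gchoose r"
  by (auto simp: gbinomial_prod_rev intro!: divide_right_mono prod_mono)

text \<open>Pascal's rule takes the place of the split of an initial segment: if \<open>F1\<close>
  were below \<open>(x - 1) gchoose (r - 1)\<close>, then \<open>F0\<close> would exceed
  \<open>(x - 1) gchoose r\<close>, and its shadow would be too large to fit into
  \<open>F1\<close>.\<close>

theorem lovasz_shadow:
  fixes F :: "'a set set"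
  assumes "finite F" "F \<subseteq> nsets UNIV r" "F \<noteq> {}" "0 < r" "real r \<le> x" "x gchoose r \<le> card F"
  shows "x gchoose (r - 1) \<le> card (shadow F)"
  using assms
proof (induction "r + card F" arbitrary: r F x rule: less_induct)
  case less
  obtain F0 F1 :: "'a set set" where F: "finite F0" "finite F1" "F0 \<subseteq> nsets UNIV r" "F1 \<subseteq> nsets UNIV (r - 1)"
    "card F1 + card F0 = card F" "shadow F0 \<subseteq> F1"
    "card F1 + card (shadow F1) \<le> card (shadow F)" "F1 \<noteq> {}"
    using shadow_reduction[OF less.prems(1-4)] by metis
  have c1: "0 < card F1" using F by (simp add: card_gt_0_iff)
  obtain s where s: "r = Suc s" using less.prems by (cases r) auto
  show ?case
  proof (cases s)
    case 0
    then show ?thesis using s F(7) c1 by simp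
  next
    case (Suc t)
    have "(x - 1) gchoose s \<le> card F1"
    proof (rule ccontr)
      assume n: "\<not> (x - 1) gchoose s \<le> card F1"
      have "x gchoose r = ((x - 1) gchoose s) + ((x - 1) gchoose r)" unfolding s by (rule gbinomial_Suc_Suc')
      then have F0: "(x - 1) gchoose r < card F0" using n less.prems(6) F(5) by linarith
      have "0 \<le> (x - 1) gchoose r" using less.prems by (intro gbinomial_nonneg_real) auto
      then have "F0 \<noteq> {}" using F0 by auto
      have fs: "card (shadow F0) \<le> card F1" using F by (intro card_mono)
      show False
      proof (cases "real r \<le> x - 1")
        case True
        then have "(x - 1) gchoose (r - 1) \<le> card (shadow F0)"
          using less.hyps[of r F0 "x - 1"] F c1 \<open>F0 \<noteq> {}\<close> less.prems F0 by simp
        then show False using n fs s by simp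
      next
        case False
        \<comment> \<open>Now \<open>x - 1 < r\<close>, outside the range of the induction
          hypothesis, but a single member of \<open>F0\<close> already has \<open>r\<close> sets in
          its shadow.\<close>
        obtain A where A: "A \<in> F0" using \<open>F0 \<noteq> {}\<close> by auto
        then have fA: "finite A" "card A = r" using F by (auto simp: nsets_def)
        have "card ((\<lambda>x. A - {x}) ` A) = r" using fA by (subst card_image) (auto simp: inj_on_def)
        moreover have "(\<lambda>x. A - {x}) ` A \<subseteq> F1" using A by (auto intro!: subsetD[OF F(6)] shadowI)
        ultimately have "r \<le> card F1" using F(2) card_mono by metis
        moreover have "(x - 1) gchoose s \<le> real r gchoose s"
          using False less.prems s by (intro gbinomial_mono_real) auto
        moreover have "real r gchoose s = real (Suc s choose s)" unfolding s by (simp only: binomial_gbinomial)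
        then have "real r gchoose s = r" using s by simp
        ultimately show False using n by linarith
      qed
    qed
    moreover from this have "(x - 1) gchoose t \<le> card (shadow F1)"
      using less.hyps[of s F1 "x - 1"] F s Suc less.prems by simp
    moreover have "x gchoose s = ((x - 1) gchoose t) + ((x - 1) gchoose s)" unfolding Suc by (rule gbinomial_Suc_Suc')
    ultimately show ?thesis using F(7) s by simp
  qed
qed

section \<open>Intersecting families with a given number of sets outside a star\<close>

definition lower_shadow :: "nat \<Rightarrow> 'a set set \<Rightarrow> 'a set set" where
  "lower_shadow l F = {C \<in> nsets UNIV l. \<exists>A\<in>F. C \<subseteq> A}"

lemma lower_shadow_self:
  assumes F: "F \<subseteq> nsets UNIV r"
  shows "lower_shadow r F = F"
proof
  show "lower_shadow r F \<subseteq> F"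
  proof
    fix C assume "C \<in> lower_shadow r F"
    then obtain A where A: "A \<in> F" "C \<subseteq> A" "card C = r" by (auto simp: lower_shadow_def nsets_def)
    then have "finite A" "card A = r" using F by (auto simp: nsets_def)
    then have "C = A" using A card_subset_eq by metis
    then show "C \<in> F" using A by simp
  qed
qed (use F in \<open>auto simp: lower_shadow_def\<close>)

lemma lower_shadow_subset: "lower_shadow l F \<subseteq> nsets UNIV l"
  by (auto simp: lower_shadow_def)

lemma finite_lower_shadow:
  assumes "finite F" "F \<subseteq> nsets UNIV r"
  shows "finite (lower_shadow l F)"
proof -
  have "lower_shadow l F \<subseteq> (\<Union>A\<in>F. Pow A)" by (auto simp: lower_shadow_def)
  moreover have "finite (\<Union>A\<in>F. Pow A)" using assms by (auto simp: nsets_def)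
  ultimately show ?thesis by (rule finite_subset)
qed

lemma shadow_lower_shadow:
  assumes F: "F \<subseteq> nsets UNIV r" and l: "l < r"
  shows "shadow (lower_shadow (Suc l) F) = lower_shadow l F"
proof (intro set_eqI iffI)
  fix C assume "C \<in> shadow (lower_shadow (Suc l) F)"
  then show "C \<in> lower_shadow l F" by (auto simp: shadow_def lower_shadow_def nsets_def)
next
  fix C assume "C \<in> lower_shadow l F"
  then obtain A where A: "A \<in> F" "C \<subseteq> A" and C: "finite C" "card C = l" by (auto simp: lower_shadow_def nsets_def)
  have "card A = r" using A F by (auto simp: nsets_def)
  then have "C \<noteq> A" using C l by auto
  then obtain x where x: "x \<in> A" "x \<notin> C" using A by auto
  then have "insert x C \<in> lower_shadow (Suc l) F" using A C by (auto simp: lower_shadow_def nsets_def)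
  then have "insert x C - {x} \<in> shadow (lower_shadow (Suc l) F)" by (intro shadowI) auto
  then show "C \<in> shadow (lower_shadow (Suc l) F)" using x by simp
qed

lemma kruskal_katona_lower:
  fixes F :: "'a set set"
  assumes "finite F" "F \<subseteq> nsets UNIV r" "colex_initial r I" "card I \<le> card F" "l \<le> r"
  shows "colex_initial l (lower_shadow l I) \<and> card (lower_shadow l I) \<le> card (lower_shadow l F)"
  using assms(5)
proof (induction rule: inc_induct)
  case base
  have "I \<subseteq> nsets UNIV r" using assms by (simp add: colex_initial_def)
  then show ?case using assms by (simp add: lower_shadow_self)
next
  case (step l)
  have "I \<subseteq> nsets UNIV r" using assms by (simp add: colex_initial_def)
  then have "shadow (lower_shadow (Suc l) I) = lower_shadow l I" "shadow (lower_shadow (Suc l) F) = lower_shadow l F"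
    using shadow_lower_shadow step(2) assms(2) by blast+
  then show ?case using kruskal_katona[OF finite_lower_shadow[OF assms(1,2)] lower_shadow_subset, of "Suc l"]
    colex_initial_shadow[of "Suc l"] step(3) by fastforce
qed

lemma lovasz_lower_shadow:
  fixes F :: "'a set set"
  assumes "finite F" "F \<subseteq> nsets UNIV r" "F \<noteq> {}" "real r \<le> x" "x gchoose r \<le> card F" "l \<le> r"
  shows "lower_shadow l F \<noteq> {} \<and> x gchoose l \<le> card (lower_shadow l F)"
  using assms(6)
proof (induction rule: inc_induct)
  case base
  then show ?case using assms by (simp add: lower_shadow_self)
next
  case (step l)
  have sh: "shadow (lower_shadow (Suc l) F) = lower_shadow l F"
    using shadow_lower_shadow step(2) assms(2) by blast
  have "x gchoose l \<le> card (lower_shadow l F)"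
    using lovasz_shadow[OF finite_lower_shadow[OF assms(1,2)] lower_shadow_subset, of "Suc l" x]
    using sh step assms(4) by auto
  moreover have "lower_shadow l F \<noteq> {}"
  proof -
    obtain C where "C \<in> lower_shadow (Suc l) F" using step by auto
    moreover from this have "C \<noteq> {}" by (auto simp: lower_shadow_def nsets_def)
    ultimately show ?thesis using shadowI[of C "lower_shadow (Suc l) F"] unfolding sh by auto
  qed
  ultimately show ?case by blast
qed

lemma lower_shadow_image:
  assumes "inj f"
  shows "lower_shadow l ((`) f ` F) = (`) f ` lower_shadow l F"
proof (intro set_eqI iffI)
  fix C assume "C \<in> lower_shadow l ((`) f ` F)"
  then obtain A where A: "A \<in> F" "C \<subseteq> f ` A" and C: "finite C" "card C = l" by (auto simp: lower_shadow_def nsets_def)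
  then obtain D where D: "D \<subseteq> A" "C = f ` D" by (meson subset_image_iff)
  have "inj_on f D" using assms inj_on_subset by blast
  then have "finite D \<and> card D = l" using D C by (auto simp: finite_image_iff card_image)
  then have "D \<in> lower_shadow l F" using A D by (auto simp: lower_shadow_def nsets_def)
  then show "C \<in> (`) f ` lower_shadow l F" using D by blast
next
  fix C assume "C \<in> (`) f ` lower_shadow l F"
  moreover have "inj_on f D" for D using assms inj_on_subset by blast
  ultimately show "C \<in> lower_shadow l ((`) f ` F)"
    by (auto simp: lower_shadow_def nsets_def card_image)
qed

text \<open>A set through \<open>i\<close> meets all members of \<open>X\<close> unless the rest of it lies in the complement
  of one of them, taken in \<open>{1..n} - {i}\<close>.\<close>

lemma card_star_crossing:
  fixes n k i :: nat
  assumes i: "i \<in> {1..n}" and k: "0 < k" and X: "X \<subseteq> nsets ({1..n} - {i}) k"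
  shows "card {A \<in> star n k i. \<forall>B\<in>X. A \<inter> B \<noteq> {}} +
     card (lower_shadow (k - 1) ((\<lambda>B. {1..n} - {i} - B) ` X)) = (n - 1) choose (k - 1)"
proof -
  define V where "V = {1..n} - {i}"
  have V: "finite V" "card V = n - 1" "i \<notin> V" using i by (auto simp: V_def)
  define G where "G = {A \<in> nsets V (k - 1). \<forall>B\<in>X. A \<inter> B \<noteq> {}}"
  define L where "L = lower_shadow (k - 1) ((\<lambda>B. V - B) ` X)"
  have "bij_betw (insert i) G {A \<in> star n k i. \<forall>B\<in>X. A \<inter> B \<noteq> {}}"
  proof (rule bij_betw_imageI)
    show "inj_on (insert i) G" using V by (intro inj_onI) (auto simp: G_def nsets_def)
    have "A \<in> insert i ` G" if A: "A \<in> star n k i" "\<forall>B\<in>X. A \<inter> B \<noteq> {}" for A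
    proof
      show "A = insert i (A - {i})" using A by (auto simp: star_def)
      have "(A - {i}) \<inter> B \<noteq> {}" if "B \<in> X" for B
      proof -
        have "i \<notin> B" using that X by (auto simp: nsets_def)
        then have "(A - {i}) \<inter> B = A \<inter> B" by auto
        then show ?thesis using that A by simp
      qed
      then show "A - {i} \<in> G" using A by (auto simp: G_def V_def star_def nsets_def)
    qed
    moreover have "insert i A \<in> star n k i \<and> (\<forall>B\<in>X. insert i A \<inter> B \<noteq> {})" if "A \<in> G" for A
    proof -
      have "i \<notin> A" "A \<subseteq> V" "finite A" "card A = k - 1" using that V by (auto simp: G_def nsets_def)
      then show ?thesis using that i k by (auto simp: G_def star_def nsets_def V_def)
    qed
    ultimately show "insert i ` G = {A \<in> star n k i. \<forall>B\<in>X. A \<inter> B \<noteq> {}}" by blast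
  qed
  then have "card {A \<in> star n k i. \<forall>B\<in>X. A \<inter> B \<noteq> {}} = card G" by (simp add: bij_betw_same_card)
  moreover have "G \<union> L = nsets V (k - 1)" "G \<inter> L = {}"
    by (auto simp: G_def L_def lower_shadow_def nsets_def)
  moreover have "finite (nsets V (k - 1))" using V by (simp add: finite_imp_finite_nsets)
  then have "finite G" "finite L" unfolding calculation(2)[symmetric] by simp_all
  ultimately have "card {A \<in> star n k i. \<forall>B\<in>X. A \<inter> B \<noteq> {}} + card L = card (nsets V (k - 1))"
    by (metis card_Un_disjoint)
  then show ?thesis using V by (simp add: L_def V_def)
qed

lemma complements_nsets:
  assumes "finite V" "X \<subseteq> nsets V k"
  shows "(\<lambda>B. V - B) ` X \<subseteq> nsets UNIV (card V - k)" "card ((\<lambda>B. V - B) ` X) = card X"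
    "finite ((\<lambda>B. V - B) ` X)"
proof -
  show "(\<lambda>B. V - B) ` X \<subseteq> nsets UNIV (card V - k)"
    using assms by (auto simp: nsets_def card_Diff_subset finite_subset)
  have "inj_on (\<lambda>B. V - B) X"
    by (rule inj_on_inverseI[of _ "\<lambda>B. V - B"]) (use assms in \<open>auto simp: nsets_def double_diff\<close>)
  then show "card ((\<lambda>B. V - B) ` X) = card X" by (rule card_image)
  show "finite ((\<lambda>B. V - B) ` X)" using assms by (auto intro: finite_subset finite_imp_finite_nsets)
qed

text \<open>Ranks in a finite linear order take each value below the cardinality exactly
  once.\<close>

lemma card_rank_less:
  fixes e :: "'a \<Rightarrow> nat"
  assumes fin: "finite Y" and inj: "inj_on e Y" and E: "E \<le> card Y"
  shows "card {A\<in>Y. card {B\<in>Y. e B < e A} < E} = E"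
proof -
  define \<rho> where "\<rho> A = card {B\<in>Y. e B < e A}" for A
  have less: "\<rho> A < \<rho> B" if "A \<in> Y" "B \<in> Y" "e A < e B" for A B
    unfolding \<rho>_def using that fin by (intro psubset_card_mono) auto
  have "inj_on \<rho> Y"
  proof (rule inj_onI, rule ccontr)
    fix A B assume AB: "A \<in> Y" "B \<in> Y" "\<rho> A = \<rho> B" "A \<noteq> B"
    then have "e A \<noteq> e B" using inj by (auto dest: inj_onD)
    then show False using less[of A B] less[of B A] AB by (auto simp: neq_iff)
  qed
  moreover have "\<rho> ` Y \<subseteq> {..<card Y}" unfolding \<rho>_def using fin
    by (auto intro!: psubset_card_mono)
  ultimately have im: "\<rho> ` Y = {..<card Y}" by (intro card_subset_eq) (simp_all add: card_image)
  have "\<rho> ` {A\<in>Y. \<rho> A < E} = {..<E}"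
  proof
    show "{..<E} \<subseteq> \<rho> ` {A\<in>Y. \<rho> A < E}"
    proof
      fix m assume m: "m \<in> {..<E}"
      then have "m \<in> \<rho> ` Y" using im E by auto
      then show "m \<in> \<rho> ` {A\<in>Y. \<rho> A < E}" using m by auto
    qed
  qed auto
  moreover have "inj_on \<rho> {A\<in>Y. \<rho> A < E}" using \<open>inj_on \<rho> Y\<close> by (rule inj_on_subset) auto
  ultimately have "card {A\<in>Y. \<rho> A < E} = E" using card_image by fastforce
  then show ?thesis by (simp add: \<rho>_def)
qed

text \<open>Complements in \<open>{2..n}\<close> have size \<open>n - 1 - k\<close>. Moving the
  ground set down by 2, so that it starts at 0, makes the complements of the final sets an initial
  segment among all sets of naturals.\<close>

lemma F_out_complements:
  fixes n k E :: nat
  assumes n: "0 < n" and k: "k < n" and E: "E \<le> (n - 1) choose k"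
  obtains I where "colex_initial (n - 1 - k) I" "card I = E" "F_out n k E \<subseteq> nsets ({1..n} - {1}) k"
    "(\<lambda>B. {1..n} - {1} - B) ` F_out n k E = (`) (\<lambda>x. x + 2) ` I"
proof -
  define V where "V = {1..n} - {1 :: nat}"
  define f where "f = (\<lambda>x. x + 2 :: nat)"
  define h where "h A = V - f ` A" for A
  define X where "X = nsets V k"
  define Y where "Y = nsets {..<n - 1} (n - 1 - k)"
  define I where "I = {A\<in>Y. card {B\<in>Y. set_encode B < set_encode A} < E}"
  have V: "finite V" "card V = n - 1" using n by (auto simp: V_def)
  have injf: "inj_on f A" for A by (auto simp: f_def inj_on_def)
  have fV: "f ` {..<n - 1} = V"
  proof
    show "V \<subseteq> f ` {..<n - 1}"
    proof
      fix x assume "x \<in> V" then show "x \<in> f ` {..<n - 1}"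
        by (intro image_eqI[of _ _ "x - 2"]) (auto simp: V_def f_def)
    qed
  qed (auto simp: V_def f_def)
  have finY: "finite Y" by (simp add: Y_def finite_imp_finite_nsets)
  have sub: "f ` A \<subseteq> V" if "A \<in> Y" for A using that fV by (auto simp: Y_def nsets_def)
  have injh: "inj_on h Y"
  proof (rule inj_onI)
    fix A B assume "A \<in> Y" "B \<in> Y" "h A = h B"
    then have "f ` A = f ` B" using sub unfolding h_def by (metis double_diff order_refl)
    then show "A = B" using injf[of UNIV] by (simp add: inj_image_eq_iff)
  qed
  have hY: "h ` Y = X"
  proof
    show "h ` Y \<subseteq> X"
    proof
      fix B assume "B \<in> h ` Y"
      then obtain A where A: "A \<in> Y" "B = V - f ` A" by (auto simp: h_def)
      then have "card (f ` A) = n - 1 - k" "finite (f ` A)" using injf by (auto simp: card_image Y_def nsets_def)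
      then have "card B = k" using A sub[OF A(1)] V k by (simp add: card_Diff_subset)
      then show "B \<in> X" using A V by (auto simp: X_def nsets_def)
    qed
    show "X \<subseteq> h ` Y"
    proof
      fix B assume B: "B \<in> X"
      have "V - B \<subseteq> f ` {..<n - 1}" using fV by auto
      then obtain A where A: "A \<subseteq> {..<n - 1}" "V - B = f ` A" by (meson subset_image_iff)
      have "finite A" using A finite_subset by blast
      moreover have "card A = n - 1 - k"
      proof -
        have "card A = card (f ` A)" using injf by (simp add: card_image)
        also have "\<dots> = card (V - B)" using A by simp
        also have "\<dots> = n - 1 - k" using B V by (simp add: X_def nsets_def card_Diff_subset)
        finally show ?thesis .
      qed
      ultimately have "A \<in> Y" using A by (auto simp: Y_def nsets_def)
      moreover have "B = h A" using A B by (auto simp: h_def X_def nsets_def)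
      ultimately show "B \<in> h ` Y" by blast
    qed
  qed
  \<comment> \<open>The factor 4 comes from the offset 2. The sum being constant, \<open>h\<close>
    reverses the order.\<close>
  have enc: "set_encode (h A) + 4 * set_encode A = set_encode V" if "A \<in> Y" for A
  proof -
    have "set_encode (f ` A) = 4 * set_encode A"
      using injf by (simp add: set_encode_def sum.reindex sum_distrib_left f_def)
    moreover have "set_encode V = set_encode (h A) + set_encode (f ` A)"
      using sub[OF that] V unfolding set_encode_def h_def by (intro sum.subset_diff) auto
    ultimately show ?thesis by simp
  qed
  have lessh: "colex_less (h A) (h B) \<longleftrightarrow> set_encode B < set_encode A" if "A \<in> Y" "B \<in> Y" for A B
  proof -
    have "finite (h A)" "finite (h B)" using V by (auto simp: h_def)
    then show ?thesis using enc[OF that(1)] enc[OF that(2)] by (simp add: colex_less_iff) linarith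
  qed
  have rank: "card {B\<in>X. colex_less (h A) B} = card {B\<in>Y. set_encode B < set_encode A}" if "A \<in> Y" for A
  proof -
    have "{B\<in>X. colex_less (h A) B} = h ` {B\<in>Y. set_encode B < set_encode A}"
      unfolding hY[symmetric] using lessh that by auto
    moreover have "inj_on h {B\<in>Y. set_encode B < set_encode A}" using injh by (rule inj_on_subset) auto
    ultimately show ?thesis by (simp add: card_image)
  qed
  have out: "F_out n k E = h ` I"
    unfolding F_out_def colex_final_def V_def[symmetric] X_def[symmetric] I_def
    using hY rank by auto
  have "colex_initial (n - 1 - k) I" unfolding colex_initial_def
  proof (intro conjI ballI impI)
    show "finite I" using finY by (simp add: I_def)
    show "I \<subseteq> nsets UNIV (n - 1 - k)" by (auto simp: I_def Y_def nsets_def)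
    fix A B assume A: "A \<in> I" and B: "B \<in> nsets UNIV (n - 1 - k)" "set_encode B < set_encode A"
    have fin: "finite A" "finite B" "A \<subseteq> {..<n - 1}" using A B by (auto simp: I_def Y_def nsets_def)
    \<comment> \<open>A set preceding a member of \<open>I\<close> cannot leave the ground set, so
      restricting to \<open>Y\<close> loses no set.\<close>
    have "B \<subseteq> {..<n - 1}"
    proof
      fix x assume "x \<in> B"
      obtain y where y: "y \<in> A" "\<And>x. y < x \<Longrightarrow> x \<in> B \<longleftrightarrow> x \<in> A"
        using set_encode_lessE[OF fin(2,1) B(2)] by metis
      show "x \<in> {..<n - 1}"
      proof (cases "y < x")
        case True then show ?thesis using y \<open>x \<in> B\<close> fin by auto
      next
        case False then show ?thesis using y(1) fin by auto
      qed
    qed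
    then have BY: "B \<in> Y" using B by (auto simp: Y_def nsets_def)
    have "card {C\<in>Y. set_encode C < set_encode B} \<le> card {C\<in>Y. set_encode C < set_encode A}"
      using finY B by (intro card_mono) auto
    then show "B \<in> I" using A BY by (auto simp: I_def)
  qed
  moreover have "card I = E" unfolding I_def
  proof (rule card_rank_less)
    show "inj_on set_encode Y" by (intro inj_onI) (auto simp: Y_def nsets_def set_encode_eq)
    have "(n - 1) choose (n - 1 - k) = (n - 1) choose k" using k binomial_symmetric[of k "n - 1"] by simp
    then show "E \<le> card Y" using E by (simp add: Y_def)
  qed (fact finY)
  moreover have "h ` I \<subseteq> X" using hY by (auto simp: I_def)
  moreover have "V - h A = f ` A" if "A \<in> I" for A using sub[of A] that by (auto simp: h_def I_def)
  then have "(\<lambda>B. V - B) ` h ` I = (`) f ` I" by (force simp: image_image)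
  ultimately show ?thesis using that[of I] unfolding out V_def X_def f_def by blast
qed

section \<open>Bounds in terms of the number of sets outside a star\<close>

lemma card_intersecting_le:
  fixes n k i :: nat
  assumes i: "i \<in> {1..n}" and k: "0 < k" and A: "\<A> \<subseteq> nsets {1..n} k" "intersecting \<A>"
  shows "card \<A> + card (lower_shadow (k - 1) ((\<lambda>B. {1..n} - {i} - B) ` (\<A> - star n k i)))
     \<le> card (\<A> - star n k i) + ((n - 1) choose (k - 1))"
proof -
  let ?X = "\<A> - star n k i"
  have fin: "finite \<A>" using A by (meson finite_atLeastAtMost finite_imp_finite_nsets finite_subset)
  have X: "?X \<subseteq> nsets ({1..n} - {i}) k" using A by (auto simp: star_def nsets_def)
  have "\<A> \<inter> star n k i \<subseteq> {A \<in> star n k i. \<forall>B\<in>?X. A \<inter> B \<noteq> {}}"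
    using A by (auto simp: intersecting_def)
  moreover have "finite (star n k i)" by (auto simp: star_def finite_imp_finite_nsets)
  ultimately have "card (\<A> \<inter> star n k i) \<le> card {A \<in> star n k i. \<forall>B\<in>?X. A \<inter> B \<noteq> {}}"
    by (intro card_mono) auto
  moreover have "card \<A> = card ?X + card (\<A> \<inter> star n k i)"
    using fin by (metis add.commute card_Int_Diff)
  ultimately show ?thesis using card_star_crossing[OF i k X] by simp
qed

text \<open>Both sizes compare with \<open>E\<close> plus a full star minus a lower shadow of
  \<open>E\<close> complements: \<open>F_E\<close> has exactly this size, the given family at most.
  The initial segment has the smallest lower shadow.\<close>

theorem card_intersecting_le_F_family:
  fixes n k i :: nat
  assumes i: "i \<in> {1..n}" and k: "0 < k" "2 * k < n" and A: "\<A> \<subseteq> nsets {1..n} k" "intersecting \<A>"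
  shows "card \<A> \<le> card (F_family n k (card (\<A> - star n k i)))"
proof -
  let ?X = "\<A> - star n k i"
  define E where "E = card ?X"
  have X: "?X \<subseteq> nsets ({1..n} - {i}) k" using A by (auto simp: star_def nsets_def)
  have V: "finite ({1..n} - {i})" "card ({1..n} - {i}) = n - 1" "finite ({1..n} - {1})" "card ({1..n} - {1}) = n - 1" using i by auto
  have "E \<le> card (nsets ({1..n} - {i}) k)" unfolding E_def
    using X V by (intro card_mono) (auto simp: finite_imp_finite_nsets)
  then have E: "E \<le> (n - 1) choose k" using V by simp
  obtain I where I: "colex_initial (n - 1 - k) I" "card I = E" "F_out n k E \<subseteq> nsets ({1..n} - {1}) k"
    "(\<lambda>B. {1..n} - {1} - B) ` F_out n k E = (`) (\<lambda>x. x + 2) ` I"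
    using F_out_complements[OF _ _ E] k by auto
  note C = complements_nsets[OF V(1) X] 
  have inj: "inj (\<lambda>x. x + 2 :: nat)" by (simp add: inj_def)
  have inj': "inj ((`) (\<lambda>x. x + 2 :: nat))" using inj by (simp add: inj_image_eq_iff inj_def)
  have out: "card (F_out n k E) = E"
    using complements_nsets(2)[OF V(3) I(3)] I(2,4) card_image[OF inj_on_subset[OF inj' subset_UNIV]] by metis
  have kk: "card (lower_shadow (k - 1) I) \<le> card (lower_shadow (k - 1) ((\<lambda>B. {1..n} - {i} - B) ` ?X))"
    by (rule kruskal_katona_lower[OF C(3) _ I(1), THEN conjunct2]) (use C V(2) I(2) k in \<open>simp_all add: E_def\<close>)
  have im: "card (lower_shadow (k - 1) ((`) (\<lambda>x. x + 2) ` I)) = card (lower_shadow (k - 1) I)"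
    unfolding lower_shadow_image[OF inj] by (rule card_image[OF inj_on_subset[OF inj' subset_UNIV]])
  have fin: "finite (F_out n k E)" "finite (F_in n k E)"
    using I(3) V by (auto simp: F_in_def star_def finite_imp_finite_nsets intro: finite_subset)
  have "F_out n k E \<inter> F_in n k E = {}" using I(3) by (auto simp: F_in_def star_def nsets_def)
  then have "card (F_family n k E) = E + card (F_in n k E)"
    using fin out by (simp add: F_family_def card_Un_disjoint)
  moreover have "card (F_in n k E) + card (lower_shadow (k - 1) I) = (n - 1) choose (k - 1)"
    using card_star_crossing[of 1 n k "F_out n k E"] k I(3) unfolding I(4) im F_in_def by simp
  moreover have "card \<A> + card (lower_shadow (k - 1) ((\<lambda>B. {1..n} - {i} - B) ` ?X)) \<le> E + ((n - 1) choose (k - 1))"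
    using card_intersecting_le[OF i k(1) A] by (simp add: E_def)
  ultimately show ?thesis using kk unfolding E_def[symmetric] by linarith
qed

text \<open>The lower bound on \<open>u\<close> is strict: at \<open>u = n - k - 2\<close> the
  coefficient giving \<open>E\<close> vanishes, and the full star would violate the claim, since
  \<open>(n - k - 2) gchoose (k - 1)\<close> is positive.\<close>

theorem card_intersecting_le_gbinomial:
  fixes n k i :: nat and u :: real
  assumes i: "i \<in> {1..n}" and k: "0 < k" "2 * k < n" and A: "\<A> \<subseteq> nsets {1..n} k" "intersecting \<A>"
    and u: "real n - real k - 2 < u" "card (\<A> - star n k i) = u gchoose (n - k - 1)"
  shows "card \<A> \<le> real ((n - 1) choose (k - 1)) - (u gchoose (k - 1)) + card (\<A> - star n k i)"
proof -
  let ?X = "\<A> - star n k i"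
  have X: "?X \<subseteq> nsets ({1..n} - {i}) k" using A by (auto simp: star_def nsets_def)
  have V: "finite ({1..n} - {i})" "card ({1..n} - {i}) = n - 1" using i by auto
  note C = complements_nsets[OF V(1) X] 
  have r: "n - 1 - k = n - k - 1" "real (n - k - 1) = real n - real k - 1" using k by auto
  have "0 < u gchoose (n - k - 1)"
    using u(1) r(2) by (auto simp: gbinomial_prod_rev intro!: divide_pos_pos prod_pos)
  then have c: "1 \<le> card ?X" using u(2) by (metis One_nat_def Suc_leI of_nat_0_less_iff)
  \<comment> \<open>Lovasz's theorem asks for \<open>u\<close> to be at least the size of the
    complements. Below it the coefficient would be less than 1, but \<open>E\<close> is a positive
    integer.\<close>
  have ur: "real (n - k - 1) \<le> u"
  proof (rule ccontr)
    assume n: "\<not> ?thesis"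
    have "u gchoose (n - k - 1) < real (n - k - 1) gchoose (n - k - 1)"
      unfolding gbinomial_prod_rev
    proof (rule divide_strict_right_mono)
      show "(\<Prod>j = 0..<n - k - 1. u - real j) < (\<Prod>j = 0..<n - k - 1. real (n - k - 1) - real j)"
        by (rule prod_mono_strict[of 0]) (use k n r u(1) in auto)
    qed simp
    also have "\<dots> = 1" using binomial_gbinomial[of "n - k - 1" "n - k - 1", where ?'a = real] by simp
    finally show False using c u(2) by simp
  qed
  have "?X \<noteq> {}" using c by (metis card.empty not_one_le_zero)
  then have "(\<lambda>B. {1..n} - {i} - B) ` ?X \<noteq> {}" by (simp only: image_is_empty not_False_eq_True)
  then have "u gchoose (k - 1) \<le> card (lower_shadow (k - 1) ((\<lambda>B. {1..n} - {i} - B) ` ?X))"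
    using lovasz_lower_shadow[OF C(3), of "n - k - 1" u "k - 1"] C(1,2) V(2) ur u(2) k r by simp
  then show ?thesis using card_intersecting_le[OF i k(1) A] by linarith
qed

section \<open>The spectrum of the Kneser graph\<close>

text \<open>The kernel of the operator that sums a function on j-sets over the supersets of each
  (j-1)-set. Lifted to k-sets, these kernels are the common eigenspaces of the Johnson scheme. The
  form \<open>j = Suc m\<close> leaves degree 0 unconstrained.\<close>

definition harmonic :: "'a set \<Rightarrow> nat \<Rightarrow> ('a set \<Rightarrow> real) \<Rightarrow> bool" where
  "harmonic V j \<phi> \<longleftrightarrow> (\<forall>m B. j = Suc m \<longrightarrow> B \<in> nsets V m \<longrightarrow> (\<Sum>x\<in>V - B. \<phi> (insert x B)) = 0)"

definition lift :: "nat \<Rightarrow> ('a set \<Rightarrow> real) \<Rightarrow> 'a set \<Rightarrow> real" where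
  "lift j \<phi> A = (\<Sum>J\<in>nsets A j. \<phi> J)"

lemma sum_nsets_Suc:
  fixes g :: "'a set \<Rightarrow> 'a \<Rightarrow> 'b::comm_monoid_add"
  assumes "finite V"
  shows "(\<Sum>K\<in>nsets V m. \<Sum>x\<in>V - K. g K x) = (\<Sum>J\<in>nsets V (Suc m). \<Sum>x\<in>J. g (J - {x}) x)"
proof -
  have fin: "finite (nsets V l)" "\<And>J. J \<in> nsets V l \<Longrightarrow> finite J" for l
    using assms by (auto simp: finite_imp_finite_nsets nsets_def)
  have "(\<Sum>K\<in>nsets V m. \<Sum>x\<in>V - K. g K x) = (\<Sum>(K, x)\<in>Sigma (nsets V m) (\<lambda>K. V - K). g K x)"
    using fin assms by (simp add: sum.Sigma)
  also have "\<dots> = (\<Sum>(J, x)\<in>Sigma (nsets V (Suc m)) (\<lambda>J. J). g (J - {x}) x)"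
    by (rule sum.reindex_bij_witness[of _ "\<lambda>(J, x). (J - {x}, x)" "\<lambda>(K, x). (insert x K, x)"])
      (auto simp: nsets_def)
  also have "\<dots> = (\<Sum>J\<in>nsets V (Suc m). \<Sum>x\<in>J. g (J - {x}) x)"
    using fin by (simp add: sum.Sigma)
  finally show ?thesis .
qed

text \<open>Add up the harmonic relations of all (j-1)-sets \<open>K\<close> with
  \<open>card (K \<inter> B) = i\<close>. A set \<open>J\<close> with \<open>i + 1\<close> points in
  \<open>B\<close> is reached by deleting any of these; one with \<open>i\<close> points in
  \<open>B\<close>, by deleting any of its \<open>j - i\<close> points outside.\<close>

lemma harmonic_sum_Suc:
  assumes V: "finite V" and h: "harmonic V j \<phi>" and B: "B \<subseteq> V" and i: "i < j"
  shows "real (Suc i) * (\<Sum>J | J \<in> nsets V j \<and> card (J \<inter> B) = Suc i. \<phi> J) =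
    - real (j - i) * (\<Sum>J | J \<in> nsets V j \<and> card (J \<inter> B) = i. \<phi> J)"
proof -
  obtain m where j: "j = Suc m" using i by (cases j) auto
  have fin: "finite (nsets V j)" using V by (simp add: finite_imp_finite_nsets)
  have "0 = (\<Sum>K\<in>nsets V m. of_bool (card (K \<inter> B) = i) * (\<Sum>x\<in>V - K. \<phi> (insert x K)))"
    using h j by (simp add: harmonic_def)
  also have "\<dots> = (\<Sum>K\<in>nsets V m. \<Sum>x\<in>V - K. of_bool (card (K \<inter> B) = i) * \<phi> (insert x K))"
    by (simp add: sum_distrib_left)
  also have "\<dots> = (\<Sum>J\<in>nsets V j. \<Sum>x\<in>J. of_bool (card ((J - {x}) \<inter> B) = i) * \<phi> (insert x (J - {x})))"
    unfolding j by (rule sum_nsets_Suc[OF V])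
  also have "\<dots> = (\<Sum>J\<in>nsets V j. \<phi> J * (real (Suc i) * of_bool (card (J \<inter> B) = Suc i) 
      + real (j - i) * of_bool (card (J \<inter> B) = i)))"
  proof (rule sum.cong[OF refl])
    fix J assume J: "J \<in> nsets V j"
    then have fJ: "finite J" "card J = j" by (auto simp: nsets_def)
    have "(\<Sum>x\<in>J. of_bool (card ((J - {x}) \<inter> B) = i) * \<phi> (insert x (J - {x}))) =
      (\<Sum>x\<in>J. of_bool (card ((J - {x}) \<inter> B) = i)) * \<phi> J"
      unfolding sum_distrib_right by (rule sum.cong) (auto simp: insert_absorb)
    also have "(\<Sum>x\<in>J. of_bool (card ((J - {x}) \<inter> B) = i)) =
      (\<Sum>x\<in>J \<inter> B. of_bool (card ((J - {x}) \<inter> B) = i)) + (\<Sum>x\<in>J - B. of_bool (card ((J - {x}) \<inter> B) = i) :: real)"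
      using fJ(1) by (rule sum.Int_Diff)
    also have "(\<Sum>x\<in>J \<inter> B. of_bool (card ((J - {x}) \<inter> B) = i)) = (\<Sum>x\<in>J \<inter> B. of_bool (card (J \<inter> B) = Suc i) :: real)"
    proof (rule sum.cong[OF refl])
      fix x assume x: "x \<in> J \<inter> B"
      have "(J - {x}) \<inter> B = J \<inter> B - {x}" by auto
      then have "card ((J - {x}) \<inter> B) = card (J \<inter> B) - 1" using x by (simp add: card_Diff_singleton)
      moreover have "0 < card (J \<inter> B)" using x fJ by (auto simp: card_gt_0_iff)
      ultimately show "of_bool (card ((J - {x}) \<inter> B) = i) = (of_bool (card (J \<inter> B) = Suc i) :: real)" by auto
    qed
    also have "\<dots> = real (Suc i) * of_bool (card (J \<inter> B) = Suc i)" by simp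
    also have "(\<Sum>x\<in>J - B. of_bool (card ((J - {x}) \<inter> B) = i)) = (\<Sum>x\<in>J - B. of_bool (card (J \<inter> B) = i) :: real)"
    proof (rule sum.cong[OF refl])
      fix x assume x: "x \<in> J - B"
      then have "(J - {x}) \<inter> B = J \<inter> B" by auto
      then show "of_bool (card ((J - {x}) \<inter> B) = i) = (of_bool (card (J \<inter> B) = i) :: real)" by simp
    qed
    also have "\<dots> = real (j - i) * of_bool (card (J \<inter> B) = i)"
      using fJ card_Diff_subset_Int[of J B] by auto
    finally show "(\<Sum>x\<in>J. of_bool (card ((J - {x}) \<inter> B) = i) * \<phi> (insert x (J - {x}))) =
      \<phi> J * (real (Suc i) * of_bool (card (J \<inter> B) = Suc i) + real (j - i) * of_bool (card (J \<inter> B) = i))"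
      by (simp only: mult.commute)
  qed
  also have "\<dots> = real (Suc i) * (\<Sum>J\<in>nsets V j. of_bool (card (J \<inter> B) = Suc i) * \<phi> J)
     + real (j - i) * (\<Sum>J\<in>nsets V j. of_bool (card (J \<inter> B) = i) * \<phi> J)"
    by (simp add: algebra_simps sum.distrib sum_distrib_left)
  finally have "real (Suc i) * (\<Sum>J\<in>nsets V j. of_bool (card (J \<inter> B) = Suc i) * \<phi> J) =
     - real (j - i) * (\<Sum>J\<in>nsets V j. of_bool (card (J \<inter> B) = i) * \<phi> J)" by linarith
  moreover have "(\<Sum>J\<in>nsets V j. of_bool (card (J \<inter> B) = l) * \<phi> J) = (\<Sum>J | J \<in> nsets V j \<and> card (J \<inter> B) = l. \<phi> J)" for l
    unfolding sum.inter_filter[OF fin] by (intro sum.cong) auto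
  ultimately show ?thesis by (simp only:)
qed

lemma harmonic_sum:
  assumes V: "finite V" and h: "harmonic V j \<phi>" and B: "B \<subseteq> V" and i: "i \<le> j"
  shows "(\<Sum>J | J \<in> nsets V j \<and> card (J \<inter> B) = i. \<phi> J) =
    (- 1) ^ i * real (j choose i) * (\<Sum>J | J \<in> nsets V j \<and> card (J \<inter> B) = 0. \<phi> J)"
  using i
proof (induction i)
  case (Suc i)
  let ?T = "\<Sum>J | J \<in> nsets V j \<and> card (J \<inter> B) = 0. \<phi> J"
  have "Suc i * (j choose Suc i) = (j - i) * (j choose i)"
    by (metis binomial_absorb_comp binomial_absorption)
  then have c: "real (Suc i) * real (j choose Suc i) = real (j - i) * real (j choose i)"
    by (metis of_nat_mult)
  have "real (Suc i) * (\<Sum>J | J \<in> nsets V j \<and> card (J \<inter> B) = Suc i. \<phi> J) =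
    - real (j - i) * (\<Sum>J | J \<in> nsets V j \<and> card (J \<inter> B) = i. \<phi> J)"
    using Suc.prems by (intro harmonic_sum_Suc[OF V h B]) simp
  also have "\<dots> = - real (j - i) * ((- 1) ^ i * real (j choose i) * ?T)"
    using Suc by simp
  also have "\<dots> = (- 1) ^ Suc i * (real (j - i) * real (j choose i)) * ?T" by simp
  also have "\<dots> = real (Suc i) * ((- 1) ^ Suc i * real (j choose Suc i) * ?T)"
    unfolding c[symmetric] by (simp only: mult_ac)
  finally show ?case by (simp only: mult_cancel_left) simp
qed simp

lemma lift_eq_sum:
  assumes "finite V" "B \<subseteq> V"
  shows "lift j \<phi> B = (\<Sum>J | J \<in> nsets V j \<and> card (J \<inter> B) = j. \<phi> J)"
proof -
  have "J \<in> nsets B j \<longleftrightarrow> J \<in> nsets V j \<and> card (J \<inter> B) = j" for J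
  proof
    assume "J \<in> nsets B j"
    moreover from this have "J \<inter> B = J" by (auto simp: nsets_def)
    ultimately show "J \<in> nsets V j \<and> card (J \<inter> B) = j" using assms by (auto simp: nsets_def)
  next
    assume J: "J \<in> nsets V j \<and> card (J \<inter> B) = j"
    then have "J \<inter> B = J" by (intro card_subset_eq) (auto simp: nsets_def)
    then show "J \<in> nsets B j" using J by (auto simp: nsets_def)
  qed
  then have "nsets B j = {J. J \<in> nsets V j \<and> card (J \<inter> B) = j}" by blast
  then show ?thesis by (simp add: lift_def)
qed

text \<open>The two ends of \<open>harmonic_sum\<close>: j-sets disjoint from \<open>B\<close>
  against j-sets contained in \<open>B\<close>.\<close>

lemma lift_complement:
  assumes V: "finite V" and h: "harmonic V j \<phi>" and B: "B \<subseteq> V"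
  shows "lift j \<phi> (V - B) = (- 1) ^ j * lift j \<phi> B"
proof -
  have "nsets (V - B) j = {J. J \<in> nsets V j \<and> card (J \<inter> B) = 0}"
    using V by (auto simp: nsets_def)
  then have "lift j \<phi> (V - B) = (\<Sum>J | J \<in> nsets V j \<and> card (J \<inter> B) = 0. \<phi> J)" by (simp add: lift_def)
  moreover have "lift j \<phi> B = (- 1) ^ j * (\<Sum>J | J \<in> nsets V j \<and> card (J \<inter> B) = 0. \<phi> J)"
    using harmonic_sum[OF V h B, of j] lift_eq_sum[OF V B] by simp
  ultimately show ?thesis by (simp add: mult.assoc[symmetric] power_add[symmetric])
qed

lemma card_nsets_superset:
  assumes "finite W" "J \<subseteq> W" "card J \<le> k"
  shows "card {A \<in> nsets W k. J \<subseteq> A} = (card W - card J) choose (k - card J)"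
proof -
  have fJ: "finite J" using assms finite_subset by blast
  have u: "card (C \<union> J) = card C + card J" if "C \<subseteq> W - J" "finite C" for C
    using that fJ by (intro card_Un_disjoint) auto
  have "bij_betw (\<lambda>C. C \<union> J) (nsets (W - J) (k - card J)) {A \<in> nsets W k. J \<subseteq> A}"
    by (rule bij_betw_byWitness[where f' = "\<lambda>A. A - J"])
      (use assms fJ in \<open>auto simp: nsets_def u card_Diff_subset\<close>)
  then have "card {A \<in> nsets W k. J \<subseteq> A} = card (nsets (W - J) (k - card J))"
    by (rule bij_betw_same_card[symmetric])
  then show ?thesis using assms fJ by (simp add: card_Diff_subset)
qed

lemma sum_lift:
  assumes W: "finite W" and j: "j \<le> k"
  shows "(\<Sum>A\<in>nsets W k. lift j \<phi> A) = real ((card W - j) choose (k - j)) * lift j \<phi> W"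
proof -
  have fin: "finite (nsets W l)" for l using W by (simp add: finite_imp_finite_nsets)
  have "(\<Sum>A\<in>nsets W k. lift j \<phi> A) = (\<Sum>A\<in>nsets W k. \<Sum>J | J \<in> nsets W j \<and> J \<subseteq> A. \<phi> J)"
    unfolding lift_def by (intro sum.cong) (auto simp: nsets_def)
  also have "\<dots> = (\<Sum>J\<in>nsets W j. \<Sum>A | A \<in> nsets W k \<and> J \<subseteq> A. \<phi> J)"
    using fin by (intro sum.swap_restrict) auto
  also have "\<dots> = (\<Sum>J\<in>nsets W j. real ((card W - j) choose (k - j)) * \<phi> J)"
  proof (rule sum.cong[OF refl])
    fix J assume "J \<in> nsets W j"
    then have "card {A \<in> nsets W k. J \<subseteq> A} = (card W - j) choose (k - j)"
      using W j card_nsets_superset[of W J k] by (simp add: nsets_def)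
    then show "(\<Sum>A | A \<in> nsets W k \<and> J \<subseteq> A. \<phi> J) = real ((card W - j) choose (k - j)) * \<phi> J" by simp
  qed
  finally show ?thesis by (simp add: lift_def sum_distrib_left)
qed

text \<open>Lifts of harmonic functions are the eigenvectors of the Kneser graph.\<close>

lemma kneser_lift:
  assumes V: "finite V" and h: "harmonic V j \<phi>" and B: "B \<in> nsets V k" and j: "j \<le> k"
  shows "(\<Sum>A\<in>nsets (V - B) k. lift j \<phi> A) = (- 1) ^ j * real ((card V - k - j) choose (k - j)) * lift j \<phi> B"
proof -
  have "B \<subseteq> V" "card (V - B) = card V - k" using B by (auto simp: nsets_def card_Diff_subset)
  then show ?thesis using V j sum_lift[of "V - B" j k \<phi>] lift_complement[OF V h, of B] by simp
qed

text \<open>The j-subsets of \<open>insert x B\<close> without \<open>x\<close> contribute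
  \<open>card V - m\<close> copies of \<open>lift j \<phi> B\<close>. Those with \<open>x\<close>
  have \<open>j - 1\<close> points in \<open>B\<close>, and \<open>harmonic_sum_Suc\<close>
  evaluates their total as \<open>- j\<close> copies.\<close>

lemma down_lift:
  assumes V: "finite V" and h: "harmonic V j \<phi>" and B: "B \<in> nsets V m"
  shows "(\<Sum>x\<in>V - B. lift j \<phi> (insert x B)) = (real (card V) - real m - real j) * lift j \<phi> B"
proof -
  have fB: "B \<subseteq> V" "finite B" "card B = m" using B by (auto simp: nsets_def)
  have cV: "real (card (V - B)) = real (card V) - real m"
    using fB V card_mono[OF V fB(1)] by (simp add: card_Diff_subset of_nat_diff)
  have fin: "finite (nsets V j)" using V by (simp add: finite_imp_finite_nsets)
  have split: "lift j \<phi> (insert x B) = lift j \<phi> B + (\<Sum>J | J \<in> nsets V j \<and> x \<in> J \<and> J - {x} \<subseteq> B. \<phi> J)" if x: "x \<in> V - B" for x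
  proof -
    have "nsets (insert x B) j = nsets B j \<union> {J. J \<in> nsets V j \<and> x \<in> J \<and> J - {x} \<subseteq> B}"
      using x fB by (auto simp: nsets_def)
    moreover have "nsets B j \<inter> {J. J \<in> nsets V j \<and> x \<in> J \<and> J - {x} \<subseteq> B} = {}"
      using x by (auto simp: nsets_def)
    ultimately show ?thesis unfolding lift_def using fin fB
      by (simp add: sum.union_disjoint finite_imp_finite_nsets)
  qed
  have "(\<Sum>x\<in>V - B. \<Sum>J | J \<in> nsets V j \<and> x \<in> J \<and> J - {x} \<subseteq> B. \<phi> J) =
      (\<Sum>J\<in>nsets V j. \<Sum>x | x \<in> V - B \<and> x \<in> J \<and> J - {x} \<subseteq> B. \<phi> J)"
    using V fin by (intro sum.swap_restrict) auto
  also have "\<dots> = - real j * lift j \<phi> B"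
  proof (cases j)
    case 0
    then show ?thesis by (auto intro!: sum.neutral simp: nsets_def)
  next
    case (Suc l)
    have "(\<Sum>x | x \<in> V - B \<and> x \<in> J \<and> J - {x} \<subseteq> B. \<phi> J) = (if card (J \<inter> B) = l then \<phi> J else 0)"
      if J: "J \<in> nsets V j" for J
    proof -
      have fJ: "finite J" "card J = Suc l" "J \<subseteq> V" using J Suc by (auto simp: nsets_def)
      have cd: "card (J - B) = Suc l - card (J \<inter> B)" using fJ by (metis card_Diff_subset_Int finite_Int)
      have le: "card (J \<inter> B) \<le> Suc l" using fJ card_mono[of J "J \<inter> B"] by simp
      show ?thesis
      proof (cases "card (J \<inter> B) = l")
        case True
        then have "card (J - B) = 1" using cd by simp
        then obtain y where "J - B = {y}" by (meson card_1_singletonE)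
        then have "{x. x \<in> V - B \<and> x \<in> J \<and> J - {x} \<subseteq> B} = {y}" using fJ by auto
        then show ?thesis using True by simp
      next
        case False
        have "\<not> (x \<in> V - B \<and> x \<in> J \<and> J - {x} \<subseteq> B)" for x
        proof
          assume "x \<in> V - B \<and> x \<in> J \<and> J - {x} \<subseteq> B"
          then have "J - B = {x}" by auto
          then have "card (J - B) = 1" by simp
          then show False using cd le False by simp
        qed
        then have e: "{x. x \<in> V - B \<and> x \<in> J \<and> J - {x} \<subseteq> B} = {}" by blast
        show ?thesis using False unfolding e by simp
      qed
    qed
    then have "(\<Sum>J\<in>nsets V j. \<Sum>x | x \<in> V - B \<and> x \<in> J \<and> J - {x} \<subseteq> B. \<phi> J) =
       (\<Sum>J\<in>nsets V j. if card (J \<inter> B) = l then \<phi> J else 0)" by (intro sum.cong) auto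
    also have "\<dots> = (\<Sum>J | J \<in> nsets V j \<and> card (J \<inter> B) = l. \<phi> J)"
      using fin by (rule sum.inter_filter[symmetric])
    also have "\<dots> = - real j * (\<Sum>J | J \<in> nsets V j \<and> card (J \<inter> B) = j. \<phi> J)"
      using harmonic_sum_Suc[OF V h fB(1), of l] Suc by (simp add: algebra_simps)
    finally show ?thesis using lift_eq_sum[OF V fB(1)] by simp
  qed
  finally have "(\<Sum>x\<in>V - B. \<Sum>J | J \<in> nsets V j \<and> x \<in> J \<and> J - {x} \<subseteq> B. \<phi> J) = - real j * lift j \<phi> B" .
  moreover have "(\<Sum>x\<in>V - B. lift j \<phi> (insert x B)) =
     (\<Sum>x\<in>V - B. lift j \<phi> B) + (\<Sum>x\<in>V - B. \<Sum>J | J \<in> nsets V j \<and> x \<in> J \<and> J - {x} \<subseteq> B. \<phi> J)"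
    unfolding sum.distrib[symmetric] using split by (rule sum.cong[OF refl])
  ultimately show ?thesis using cV by (simp add: algebra_simps)
qed

lemma lift_scale: "lift j (\<lambda>J. c * \<phi> J) A = c * lift j \<phi> A"
  by (simp add: lift_def sum_distrib_left)

lemma harmonic_scale: "harmonic V j \<phi> \<Longrightarrow> harmonic V j (\<lambda>J. c * \<phi> J)"
  by (simp add: harmonic_def sum_distrib_left[symmetric])

text \<open>Decompose the down-sums of \<open>f\<close>, which live one level lower, and divide each
  component by its factor from \<open>down_lift\<close>, positive in this range. Subtracting the
  lifts leaves a function with vanishing down-sums: it is harmonic of top degree and its own
  lift.\<close>

lemma harmonic_decomposition:
  assumes V: "finite V" and k: "2 * k \<le> card V"
  shows "\<exists>\<phi>. (\<forall>j\<le>k. harmonic V j (\<phi> j)) \<and> (\<forall>A\<in>nsets V k. f A = (\<Sum>j\<le>k. lift j (\<phi> j) A))"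
  using k
proof (induction k arbitrary: f)
  case 0
  show ?case
    by (rule exI[of _ "\<lambda>_. f"]) (auto simp: harmonic_def lift_def)
next
  case (Suc k)
  obtain \<phi> where \<phi>: "\<And>j. j \<le> k \<Longrightarrow> harmonic V j (\<phi> j)"
    "\<And>B. B \<in> nsets V k \<Longrightarrow> (\<Sum>x\<in>V - B. f (insert x B)) = (\<Sum>j\<le>k. lift j (\<phi> j) B)"
    using Suc.IH[of "\<lambda>B. \<Sum>x\<in>V - B. f (insert x B)"] Suc.prems by auto
  define \<psi> where "\<psi> j = (\<lambda>J. 1 / (real (card V) - real k - real j) * \<phi> j J)" for j
  define g where "g A = f A - (\<Sum>j\<le>k. lift j (\<psi> j) A)" for A
  have h: "harmonic V j (\<psi> j)" if "j \<le> k" for j unfolding \<psi>_def using \<phi>(1)[OF that] by (rule harmonic_scale)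
  have "harmonic V (Suc k) g"
    unfolding harmonic_def
  proof (intro allI impI)
    fix m B assume m: "Suc k = Suc m" and "B \<in> nsets V m"
    then have B: "B \<in> nsets V k" by simp
    have "(\<Sum>x\<in>V - B. \<Sum>j\<le>k. lift j (\<psi> j) (insert x B)) = (\<Sum>j\<le>k. \<Sum>x\<in>V - B. lift j (\<psi> j) (insert x B))"
      by (rule sum.swap)
    also have "\<dots> = (\<Sum>j\<le>k. lift j (\<phi> j) B)"
    proof (rule sum.cong[OF refl])
      fix j assume j: "j \<in> {..k}"
      then have "(\<Sum>x\<in>V - B. lift j (\<psi> j) (insert x B)) = (real (card V) - real k - real j) * lift j (\<psi> j) B"
        using down_lift[OF V h B] by simp
      also have "\<dots> = lift j (\<phi> j) B" unfolding \<psi>_def lift_scale using j Suc.prems by simp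
      finally show "(\<Sum>x\<in>V - B. lift j (\<psi> j) (insert x B)) = lift j (\<phi> j) B" .
    qed
    finally show "(\<Sum>x\<in>V - B. g (insert x B)) = 0" using \<phi>(2)[OF B] by (simp add: g_def sum_subtractf)
  qed
  moreover have "lift (Suc k) g A = g A" if "A \<in> nsets V (Suc k)" for A
  proof -
    have A: "finite A" "card A = Suc k" using that by (auto simp: nsets_def)
    then have "nsets A (Suc k) = {A}" using card_subset_eq[of A] by (auto simp: nsets_def)
    then show ?thesis by (simp add: lift_def)
  qed
  ultimately show ?case
    by (intro exI[of _ "\<psi>(Suc k := g)"]) (auto simp: h le_Suc_eq g_def)
qed


section \<open>Orthogonality of the degrees and the refined Hoffman bound\<close>

lemma kneser_sum_swap:
  fixes F G :: "'a set \<Rightarrow> real"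
  assumes "finite V"
  shows "(\<Sum>B\<in>nsets V k. F B * (\<Sum>A\<in>nsets (V - B) k. G A)) = (\<Sum>A\<in>nsets V k. G A * (\<Sum>B\<in>nsets (V - A) k. F B))"
proof -
  have fin: "finite (nsets V k)" using assms by (simp add: finite_imp_finite_nsets)
  have n: "nsets (V - B) k = {A \<in> nsets V k. A \<inter> B = {}}" for B by (auto simp: nsets_def)
  have "(\<Sum>B\<in>nsets V k. \<Sum>A | A \<in> nsets V k \<and> A \<inter> B = {}. F B * G A) =
    (\<Sum>A\<in>nsets V k. \<Sum>B | B \<in> nsets V k \<and> A \<inter> B = {}. F B * G A)"
    using fin fin by (rule sum.swap_restrict)
  then show ?thesis by (simp add: n sum_distrib_left Int_commute mult.commute)
qed

lemma binomial_diag_less: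
  assumes "i < j" "j \<le> k" "2 * k < n"
  shows "(n - k - j) choose (k - j) < (n - k - i) choose (k - i)"
  using assms
proof (induction j)
  case (Suc j)
  define r where "r = k - Suc j"
  have m: "k - j = Suc r" "n - k - j = Suc (n - k - Suc j)" using Suc.prems by (auto simp: r_def)
  have "0 < (n - k - Suc j) choose Suc r" using Suc.prems by (intro zero_less_binomial) (auto simp: r_def)
  then have "(n - k - Suc j) choose (k - Suc j) < (n - k - j) choose (k - j)"
    unfolding m by (simp add: r_def)
  then show ?case using Suc by (cases "i = j") auto
qed simp

text \<open>The Kneser operator is symmetric, and by \<open>binomial_diag_less\<close> its
  eigenvalues on the two lifts differ even in absolute value.\<close>

lemma lift_orthogonal:
  assumes V: "finite V" and k: "2 * k < card V" and ij: "i \<le> k" "j \<le> k" "i \<noteq> j"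
    and h: "harmonic V i \<phi>" "harmonic V j \<psi>"
  shows "(\<Sum>A\<in>nsets V k. lift i \<phi> A * lift j \<psi> A) = 0"
proof -
  define c where "c j = real ((card V - k - j) choose (k - j))" for j
  define S where "S = (\<Sum>A\<in>nsets V k. lift i \<phi> A * lift j \<psi> A)"
  have "(\<Sum>B\<in>nsets V k. lift i \<phi> B * (\<Sum>A\<in>nsets (V - B) k. lift j \<psi> A)) = 
        (\<Sum>B\<in>nsets V k. ((- 1) ^ j * c j) * (lift i \<phi> B * lift j \<psi> B))"
    by (intro sum.cong refl) (simp add: kneser_lift[OF V h(2) _ ij(2)] c_def)
  moreover have "(\<Sum>A\<in>nsets V k. lift j \<psi> A * (\<Sum>B\<in>nsets (V - A) k. lift i \<phi> B)) = 
        (\<Sum>A\<in>nsets V k. ((- 1) ^ i * c i) * (lift i \<phi> A * lift j \<psi> A))"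
    by (intro sum.cong refl) (simp add: kneser_lift[OF V h(1) _ ij(1)] c_def)
  ultimately have "((- 1) ^ j * c j) * S = ((- 1) ^ i * c i) * S"
    using kneser_sum_swap[OF V, where k = k and F = "lift i \<phi>" and G = "lift j \<psi>"] by (simp add: S_def sum_distrib_left)
  moreover have "(- 1) ^ j * c j \<noteq> (- 1) ^ i * c i"
  proof
    assume "(- 1) ^ j * c j = (- 1) ^ i * c i"
    then have "\<bar>(- 1) ^ j * c j\<bar> = \<bar>(- 1) ^ i * c i\<bar>" by simp
    then have "c j = c i" by (simp add: abs_mult c_def)
    then show False
      using binomial_diag_less[of i j k "card V"] binomial_diag_less[of j i k "card V"] ij k
      by (cases i j rule: linorder_cases) (auto simp: c_def)
  qed
  ultimately show ?thesis by (simp add: S_def)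
qed

text \<open>The squared norms \<open>N j\<close> of the degrees add up to \<open>a\<close>,
  \<open>N 0\<close> is determined by \<open>a\<close>, and the absence of disjoint pairs makes
  their sum weighted by the eigenvalues vanish. Degree 1 has the most negative eigenvalue; keeping
  the weight \<open>W\<close> of all degrees above 1 in Hoffman's argument bounds it by the deficit
  \<open>C - a\<close>.\<close>

theorem intersecting_near_affine:
  fixes V :: "'a set" and k :: nat and \<A> :: "'a set set"
  defines "n \<equiv> card V" and "C \<equiv> real ((card V - 1) choose (k - 1))" and "a \<equiv> real (card \<A>)"
  assumes V: "finite V" and k: "0 < k" "2 * k < card V"
    and A: "\<A> \<subseteq> nsets V k" "\<And>A B. A \<in> \<A> \<Longrightarrow> B \<in> \<A> \<Longrightarrow> A \<inter> B \<noteq> {}"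
  obtains m :: real and \<phi> :: "'a \<Rightarrow> real" where
    "(\<Sum>A\<in>nsets V k. (of_bool (A \<in> \<A>) - m - (\<Sum>i\<in>A. \<phi> i))\<^sup>2) * (real n - 2 * real k) * C \<le>
       (real n - real k - 1) * a * (C - a)"
proof -
  define X where "X = nsets V k"
  have finX: "finite X" using V by (simp add: X_def finite_imp_finite_nsets)
  define f where "f A = (of_bool (A \<in> \<A>) :: real)" for A
  obtain \<phi> where \<phi>: "\<And>j. j \<le> k \<Longrightarrow> harmonic V j (\<phi> j)"
    and f: "\<And>A. A \<in> X \<Longrightarrow> f A = (\<Sum>j\<le>k. lift j (\<phi> j) A)"
    using harmonic_decomposition[OF V, of k f] k by (auto simp: X_def)
  define F where "F j = lift j (\<phi> j)" for j
  define N where "N j = (\<Sum>A\<in>X. (F j A)\<^sup>2)" for j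
  define c where "c j = real ((n - k - j) choose (k - j))" for j
  have N0: "0 \<le> N j" for j by (simp add: N_def sum_nonneg)
  have c0: "0 \<le> c j" for j by (simp add: c_def)
  have orth: "(\<Sum>A\<in>X. F i A * F j A) = 0" if "i \<le> k" "j \<le> k" "i \<noteq> j" for i j
    unfolding F_def X_def using lift_orthogonal[OF V k(2) that \<phi>[OF that(1)] \<phi>[OF that(2)]] .
  have sum_sub: "(\<Sum>A\<in>X. (\<Sum>j\<in>S. F j A)\<^sup>2) = (\<Sum>j\<in>S. N j)" if S: "S \<subseteq> {..k}" for S
  proof -
    have finS: "finite S" using S finite_subset by blast
    have "(\<Sum>A\<in>X. (\<Sum>j\<in>S. F j A)\<^sup>2) = (\<Sum>A\<in>X. \<Sum>j\<in>S. \<Sum>i\<in>S. F j A * F i A)"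
      by (simp add: power2_eq_square sum_product)
    also have "\<dots> = (\<Sum>j\<in>S. \<Sum>A\<in>X. \<Sum>i\<in>S. F j A * F i A)" by (rule sum.swap)
    also have "\<dots> = (\<Sum>j\<in>S. \<Sum>i\<in>S. \<Sum>A\<in>X. F j A * F i A)" by (intro sum.cong refl sum.swap)
    also have "\<dots> = (\<Sum>j\<in>S. \<Sum>i\<in>S. if i = j then N j else 0)"
      using S orth by (intro sum.cong refl) (auto simp: N_def power2_eq_square)
    also have "\<dots> = (\<Sum>j\<in>S. N j)" using finS by simp
    finally show ?thesis .
  qed
  have asum: "(\<Sum>A\<in>X. f A) = a"
    using A(1) finX by (simp add: f_def a_def X_def[symmetric] sum_of_bool_eq Int_absorb1)
  have a_N: "a = (\<Sum>j\<le>k. N j)"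
  proof -
    have "a = (\<Sum>A\<in>X. (f A)\<^sup>2)" unfolding asum[symmetric] by (intro sum.cong) (auto simp: f_def)
    also have "\<dots> = (\<Sum>A\<in>X. (\<Sum>j\<in>{..k}. F j A)\<^sup>2)" by (intro sum.cong refl) (simp add: f F_def)
    also have "\<dots> = (\<Sum>j\<le>k. N j)" by (rule sum_sub) simp
    finally show ?thesis .
  qed
  have kn: "0 = (\<Sum>j\<le>k. (- 1) ^ j * c j * N j)"
  proof -
    have "0 = (\<Sum>B\<in>X. f B * (\<Sum>A\<in>nsets (V - B) k. f A))"
    proof (rule sym, rule sum.neutral, rule ballI)
      fix B assume "B \<in> X"
      have "f A = 0" if "B \<in> \<A>" "A \<in> nsets (V - B) k" for A
        using that A(2)[of A B] by (auto simp: f_def nsets_def)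
      then show "f B * (\<Sum>A\<in>nsets (V - B) k. f A) = 0" by (auto simp: f_def)
    qed
    also have "\<dots> = (\<Sum>B\<in>X. (\<Sum>i\<le>k. F i B) * (\<Sum>j\<le>k. (- 1) ^ j * c j * F j B))"
    proof (rule sum.cong[OF refl])
      fix B assume B: "B \<in> X"
      have "(\<Sum>A\<in>nsets (V - B) k. f A) = (\<Sum>A\<in>nsets (V - B) k. \<Sum>j\<le>k. F j A)"
      proof (rule sum.cong[OF refl])
        fix A assume "A \<in> nsets (V - B) k"
        then have "A \<in> X" by (auto simp: X_def nsets_def)
        then show "f A = (\<Sum>j\<le>k. F j A)" unfolding F_def by (rule f)
      qed
      also have "\<dots> = (\<Sum>j\<le>k. \<Sum>A\<in>nsets (V - B) k. F j A)" by (rule sum.swap)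
      also have "\<dots> = (\<Sum>j\<le>k. (- 1) ^ j * c j * F j B)"
        using B by (intro sum.cong refl) (simp add: F_def c_def n_def X_def kneser_lift[OF V \<phi>])
      finally show "f B * (\<Sum>A\<in>nsets (V - B) k. f A) = (\<Sum>i\<le>k. F i B) * (\<Sum>j\<le>k. (- 1) ^ j * c j * F j B)"
        using B by (simp add: f F_def)
    qed
    also have "\<dots> = (\<Sum>B\<in>X. \<Sum>i\<le>k. \<Sum>j\<le>k. (- 1) ^ j * c j * (F i B * F j B))"
      by (simp add: sum_product mult_ac)
    also have "\<dots> = (\<Sum>i\<le>k. \<Sum>B\<in>X. \<Sum>j\<le>k. (- 1) ^ j * c j * (F i B * F j B))" by (rule sum.swap)
    also have "\<dots> = (\<Sum>i\<le>k. \<Sum>j\<le>k. \<Sum>B\<in>X. (- 1) ^ j * c j * (F i B * F j B))" by (intro sum.cong refl sum.swap)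
    also have "\<dots> = (\<Sum>i\<le>k. \<Sum>j\<le>k. if j = i then (- 1) ^ i * c i * N i else 0)"
      using orth by (intro sum.cong refl) (auto simp: N_def power2_eq_square sum_distrib_left[symmetric])
    also have "\<dots> = (\<Sum>j\<le>k. (- 1) ^ j * c j * N j)" by simp
    finally show ?thesis .
  qed
  have N_0: "N 0 * real (n choose k) = a\<^sup>2"
  proof -
    have F0: "F 0 A = \<phi> 0 {}" for A by (simp add: F_def lift_def)
    have "(\<Sum>A\<in>X. F j A) = 0" if "j \<le> k" "j \<noteq> 0" for j
      using lift_orthogonal[OF V k(2) _ that(1) _ _ \<phi>[OF that(1)], of 0 "\<lambda>_. 1"] that
      by (simp add: F_def X_def harmonic_def lift_def[of 0])
    then have "(\<Sum>j\<le>k. \<Sum>A\<in>X. F j A) = (\<Sum>j\<le>k. if j = 0 then \<Sum>A\<in>X. F 0 A else 0)"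
      by (intro sum.cong) auto
    then have "a = (\<Sum>A\<in>X. F 0 A)" unfolding asum[symmetric] using sum.swap[of F X "{..k}"]
      by (simp add: f F_def)
    then have "a = real (n choose k) * \<phi> 0 {}" by (simp add: F0 X_def n_def)
    moreover have "N 0 = real (n choose k) * (\<phi> 0 {})\<^sup>2" by (simp add: N_def F0 X_def n_def)
    ultimately show ?thesis by (simp add: power2_eq_square)
  qed
  define W where "W = (\<Sum>j\<in>{2..k}. N j)"
  \<comment> \<open>This is \<open>c 2\<close> in a form that is right for \<open>k = 1\<close> too:
    there \<open>c 2\<close> would be 1 by truncated subtraction, whereas \<open>L\<close> is 0 and
    no degree above 1 exists.\<close>
  define L where "L = c 1 * (real k - 1) / (real n - real k - 1)"
  have split: "(\<Sum>j\<le>k. g j) = g 0 + g 1 + (\<Sum>j\<in>{2..k}. g j)" for g :: "nat \<Rightarrow> real"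
  proof -
    have "{..k} = insert 0 (insert 1 {2..k})" using k by auto
    then show ?thesis by simp
  qed
  have nk: "2 * k < n" using k by (simp add: n_def)
  have c_le: "c j \<le> L" if "j \<in> {2..k}" for j
  proof -
    have j: "2 \<le> j" "j \<le> k" using that by auto
    have "c j \<le> c 2"
      using binomial_diag_less[of 2 j k n] j nk by (cases "j = 2") (auto simp: c_def)
    moreover have "(real n - real k - 1) * c 2 = (real k - 1) * c 1"
    proof -
      have "(k - 1) * ((n - k - 1) choose (k - 1)) = (n - k - 1) * ((n - k - 2) choose (k - 2))"
        using times_binomial_minus1_eq[of "k - 1" "n - k - 1"] j by (simp add: numeral_2_eq_2)
      then have "real (k - 1) * c 1 = real (n - k - 1) * c 2"
        unfolding c_def by (metis of_nat_mult)
      then show ?thesis using j nk by (simp add: of_nat_diff)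
    qed
    moreover have "real n - real k - 1 \<noteq> 0" using j nk by auto
    ultimately show ?thesis unfolding L_def by (metis mult.commute nonzero_mult_div_cancel_left)
  qed
  have "0 = c 0 * N 0 - c 1 * N 1 + (\<Sum>j\<in>{2..k}. (- 1) ^ j * c j * N j)"
    using kn by (simp add: split)
  moreover have "- (L * W) \<le> (\<Sum>j\<in>{2..k}. (- 1) ^ j * c j * N j)"
  proof -
    have "- L * N j \<le> (- 1) ^ j * c j * N j" if "j \<in> {2..k}" for j
    proof (rule mult_right_mono)
      show "- L \<le> (- 1) ^ j * c j" using c_le[OF that] c0[of j] by (cases "even j") auto
    qed (rule N0)
    then have "(\<Sum>j\<in>{2..k}. - L * N j) \<le> (\<Sum>j\<in>{2..k}. (- 1) ^ j * c j * N j)" by (rule sum_mono)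
    then show ?thesis by (simp add: W_def sum_distrib_left sum_negf)
  qed
  ultimately have "c 0 * N 0 - L * W \<le> c 1 * N 1" by linarith
  also have "N 1 = a - N 0 - W" using a_N by (simp add: split W_def)
  finally have main: "(c 1 - L) * W \<le> c 1 * a - (c 0 + c 1) * N 0" by (simp add: algebra_simps)
  have C1: "real k * c 0 = (real n - real k) * c 1"
  proof -
    have "k * ((n - k) choose k) = (n - k) * ((n - k - 1) choose (k - 1))"
      using k by (intro times_binomial_minus1_eq) 
    then have "real k * c 0 = real (n - k) * c 1" unfolding c_def by (simp only: of_nat_mult[symmetric] diff_zero)
    then show ?thesis using nk by (simp add: of_nat_diff)
  qed
  have C2: "real k * real (n choose k) = real n * C"
  proof -
    have "k * (n choose k) = n * ((n - 1) choose (k - 1))" using k by (intro times_binomial_minus1_eq)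
    then show ?thesis unfolding C_def n_def by (metis of_nat_mult)
  qed
  have pos: "0 < C" "0 < c 1" "0 < real n - real k - 1" "0 < real (n choose k)"
    using k nk by (auto simp: C_def c_def n_def)
  \<comment> \<open>Here \<open>c 0 + c 1\<close> equals \<open>c 1 * n / k\<close>, and
    \<open>N 0\<close> equals \<open>a^2\<close> divided by \<open>n choose k\<close>.\<close>
  have key: "(c 0 + c 1) * N 0 * C = c 1 * a\<^sup>2"
  proof -
    have "real k * real (n choose k) * ((c 0 + c 1) * N 0 * C) = (real k * c 0 + real k * c 1) * (N 0 * real (n choose k)) * C"
      by (simp add: algebra_simps)
    also have "\<dots> = real k * real (n choose k) * (c 1 * a\<^sup>2)"
      unfolding C1 C2 N_0 by (simp add: algebra_simps)
    finally show ?thesis using k pos by simp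
  qed
  have "(real n - real k - 1) * L = c 1 * (real k - 1)" using pos by (simp add: L_def)
  then have Leq: "(real n - real k - 1) * (c 1 - L) = c 1 * (real n - 2 * real k)" by (simp add: algebra_simps)
  have "c 1 * (W * (real n - 2 * real k) * C) = (real n - real k - 1) * (c 1 - L) * W * C"
    unfolding Leq by (simp add: mult_ac)
  also have "\<dots> = (real n - real k - 1) * C * ((c 1 - L) * W)" by (simp add: mult_ac)
  also have "\<dots> \<le> (real n - real k - 1) * C * (c 1 * a - (c 0 + c 1) * N 0)"
    using main pos by (intro mult_left_mono) auto
  also have "\<dots> = (real n - real k - 1) * (c 1 * a * C - (c 0 + c 1) * N 0 * C)" by (simp add: algebra_simps)
  also have "\<dots> = c 1 * ((real n - real k - 1) * a * (C - a))" unfolding key by (simp add: algebra_simps power2_eq_square)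
  finally have "W * (real n - 2 * real k) * C \<le> (real n - real k - 1) * a * (C - a)" using pos by simp
  moreover have "W = (\<Sum>A\<in>nsets V k. (of_bool (A \<in> \<A>) - \<phi> 0 {} - (\<Sum>i\<in>A. \<phi> 1 {i}))\<^sup>2)"
  proof -
    have "W = (\<Sum>A\<in>X. (\<Sum>j\<in>{2..k}. F j A)\<^sup>2)" unfolding W_def by (rule sum_sub[symmetric]) auto
    also have "\<dots> = (\<Sum>A\<in>X. (f A - F 0 A - F 1 A)\<^sup>2)"
      using f by (intro sum.cong refl) (simp add: split F_def)
    also have "\<dots> = (\<Sum>A\<in>X. (of_bool (A \<in> \<A>) - \<phi> 0 {} - (\<Sum>i\<in>A. \<phi> 1 {i}))\<^sup>2)"
      by (simp add: F_def f_def lift_def nsets_one sum.reindex)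
    finally show ?thesis by (simp add: X_def)
  qed
  ultimately show ?thesis using that by blast
qed

section \<open>Rademacher sums close to zero-one functions\<close>

text \<open>The set \<open>\<eta>\<close> collects the coordinates of sign -1, so averaging over
  random signs becomes a sum over \<open>Pow I\<close>.\<close>

definition rademacher_sum :: "('i \<Rightarrow> real) \<Rightarrow> 'i set \<Rightarrow> 'i set \<Rightarrow> real" where
  "rademacher_sum d I \<eta> = (\<Sum>s\<in>I. if s \<in> \<eta> then - d s else d s)"

lemma sum_Pow_insert:
  assumes "finite I" "t \<notin> I"
  shows "(\<Sum>\<eta>\<in>Pow (insert t I). g \<eta>) = (\<Sum>\<eta>\<in>Pow I. g \<eta> + g (insert t \<eta>))"
proof -
  have "inj_on (insert t) (Pow I)" using assms(2) by (intro inj_onI) (auto simp: insert_ident)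
  moreover have "Pow I \<inter> insert t ` Pow I = {}" using assms(2) by auto
  ultimately show ?thesis using assms by (simp add: Pow_insert sum.union_disjoint sum.reindex sum.distrib)
qed

lemma rademacher_moments:
  assumes "finite I"
  shows "(\<Sum>\<eta>\<in>Pow I. (rademacher_sum d I \<eta>)\<^sup>2) = 2 ^ card I * (\<Sum>s\<in>I. (d s)\<^sup>2)"
    and "(\<Sum>\<eta>\<in>Pow I. (rademacher_sum d I \<eta>) ^ 4) \<le> 2 ^ card I * (3 * (\<Sum>s\<in>I. (d s)\<^sup>2)\<^sup>2)"
proof -
  have "(\<Sum>\<eta>\<in>Pow I. (rademacher_sum d I \<eta>)\<^sup>2) = 2 ^ card I * (\<Sum>s\<in>I. (d s)\<^sup>2) \<and>
    (\<Sum>\<eta>\<in>Pow I. (rademacher_sum d I \<eta>) ^ 4) \<le> 2 ^ card I * (3 * (\<Sum>s\<in>I. (d s)\<^sup>2)\<^sup>2)"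
    using assms
  proof (induction I)
    case empty
    then show ?case by (simp add: rademacher_sum_def)
  next
    case (insert t I)
    let ?Y = "rademacher_sum d I" and ?\<sigma> = "\<Sum>s\<in>I. (d s)\<^sup>2"
    have Y: "rademacher_sum d (insert t I) \<eta> = ?Y \<eta> + d t" "rademacher_sum d (insert t I) (insert t \<eta>) = ?Y \<eta> - d t"
      if "\<eta> \<in> Pow I" for \<eta>
    proof -
      have "t \<notin> \<eta>" using that insert by auto
      then show "rademacher_sum d (insert t I) \<eta> = ?Y \<eta> + d t" using insert by (simp add: rademacher_sum_def)
      have "(\<Sum>s\<in>I. if s = t \<or> s \<in> \<eta> then - d s else d s) = (\<Sum>s\<in>I. if s \<in> \<eta> then - d s else d s)"
        using insert by (intro sum.cong) auto
      then show "rademacher_sum d (insert t I) (insert t \<eta>) = ?Y \<eta> - d t" using insert by (simp add: rademacher_sum_def)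
    qed
    have "(\<Sum>\<eta>\<in>Pow (insert t I). (rademacher_sum d (insert t I) \<eta>)\<^sup>2) =
       (\<Sum>\<eta>\<in>Pow I. 2 * (?Y \<eta>)\<^sup>2 + 2 * (d t)\<^sup>2)"
      unfolding sum_Pow_insert[OF insert(1,2)]
      by (intro sum.cong refl, simp only: Y, simp add: power2_eq_square algebra_simps)
    also have "\<dots> = 2 * (\<Sum>\<eta>\<in>Pow I. (?Y \<eta>)\<^sup>2) + 2 ^ card I * (2 * (d t)\<^sup>2)"
      using insert(1) by (simp add: sum.distrib sum_distrib_left card_Pow)
    also have "\<dots> = 2 ^ card (insert t I) * (\<Sum>s\<in>insert t I. (d s)\<^sup>2)"
      using insert(1,2) insert.IH[THEN conjunct1] by (simp add: algebra_simps)
    finally have 1: "(\<Sum>\<eta>\<in>Pow (insert t I). (rademacher_sum d (insert t I) \<eta>)\<^sup>2) =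
      2 ^ card (insert t I) * (\<Sum>s\<in>insert t I. (d s)\<^sup>2)" .
    have "(\<Sum>\<eta>\<in>Pow (insert t I). (rademacher_sum d (insert t I) \<eta>) ^ 4) =
       (\<Sum>\<eta>\<in>Pow I. 2 * (?Y \<eta>) ^ 4 + 12 * (d t)\<^sup>2 * (?Y \<eta>)\<^sup>2 + 2 * (d t) ^ 4)"
      unfolding sum_Pow_insert[OF insert(1,2)]
      by (intro sum.cong refl, simp only: Y, simp add: power2_eq_square power4_eq_xxxx algebra_simps)
    also have "\<dots> = 2 * (\<Sum>\<eta>\<in>Pow I. (?Y \<eta>) ^ 4) + 12 * (d t)\<^sup>2 * (\<Sum>\<eta>\<in>Pow I. (?Y \<eta>)\<^sup>2) + 2 ^ card I * (2 * (d t) ^ 4)"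
      using insert(1) by (simp add: sum.distrib sum_distrib_left card_Pow)
    \<comment> \<open>Raising the coefficient of \<open>(d t) ^ 4\<close> from 2 to 6 completes the
      square.\<close>
    also have "\<dots> \<le> 2 * (2 ^ card I * (3 * ?\<sigma>\<^sup>2)) + 12 * (d t)\<^sup>2 * (2 ^ card I * ?\<sigma>) + 2 ^ card I * (6 * (d t) ^ 4)"
      using insert.IH by (intro add_mono mult_left_mono) auto
    also have "\<dots> = 2 ^ card (insert t I) * (3 * (\<Sum>s\<in>insert t I. (d s)\<^sup>2)\<^sup>2)"
      using insert(1,2) by (simp add: power2_eq_square power4_eq_xxxx algebra_simps)
    finally show ?case using 1 by blast
  qed
  then show "(\<Sum>\<eta>\<in>Pow I. (rademacher_sum d I \<eta>)\<^sup>2) = 2 ^ card I * (\<Sum>s\<in>I. (d s)\<^sup>2)"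
    and "(\<Sum>\<eta>\<in>Pow I. (rademacher_sum d I \<eta>) ^ 4) \<le> 2 ^ card I * (3 * (\<Sum>s\<in>I. (d s)\<^sup>2)\<^sup>2)" by auto
qed

lemma rademacher_flip:
  assumes "finite I" "T \<subseteq> I"
  shows "rademacher_sum d I \<eta> - rademacher_sum d I (sym_diff \<eta> T) = 2 * rademacher_sum (\<lambda>s. if s \<in> T then d s else 0) I \<eta>"
  unfolding rademacher_sum_def sum_subtractf[symmetric] sum_distrib_left by (intro sum.cong) auto

lemma sum_Pow_flip:
  assumes "T \<subseteq> I"
  shows "(\<Sum>\<eta>\<in>Pow I. g (sym_diff \<eta> T)) = (\<Sum>\<eta>\<in>Pow I. g \<eta>)"
  by (rule sum.reindex_bij_witness[of _ "\<lambda>\<eta>. sym_diff \<eta> T" "\<lambda>\<eta>. sym_diff \<eta> T"])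
    (use assms in \<open>auto intro!: arg_cong[of _ _ g]\<close>)

text \<open>A polynomial lower bound for the squared distance to \<open>{0, 1/2, -1/2}\<close>, even
  and of degree four so that averaging it takes only second and fourth moments.\<close>

lemma quartic_bound:
  fixes y z :: real
  assumes "z = 0 \<or> z = 1 / 2 \<or> z = - 1 / 2"
  shows "y\<^sup>2 / 8 - (y - z)\<^sup>2 \<le> y ^ 4"
proof -
  have q: "y\<^sup>2 / 4 - 1 / 64 \<le> y ^ 4"
    using zero_le_power2[of "y\<^sup>2 - 1 / 8"] by (simp add: power2_eq_square power4_eq_xxxx algebra_simps)
  show ?thesis
    using assms
  proof (elim disjE)
    assume z: "z = 0"
    have "0 \<le> y ^ 4" "0 \<le> y\<^sup>2" by simp_all
    then show ?thesis unfolding z diff_zero by linarith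
  next
    assume z: "z = 1 / 2"
    \<comment> \<open>After \<open>q\<close>, a quadratic remains to be shown nonnegative;
      \<open>4 / 9\<close> is its minimum point.\<close>
    have "0 \<le> (y - 4 / 9)\<^sup>2" by simp
    then show ?thesis using q unfolding z by (simp add: power2_eq_square algebra_simps)
  next
    assume z: "z = - 1 / 2"
    have "0 \<le> (y + 4 / 9)\<^sup>2" by simp
    then show ?thesis using q unfolding z by (simp add: power2_eq_square algebra_simps)
  qed
qed

lemma half_diff_square_le:
  fixes a b :: real
  shows "((a - b) / 2)\<^sup>2 \<le> (a\<^sup>2 + b\<^sup>2) / 2"
  using zero_le_power2[of "a + b"] by (simp add: power2_eq_square field_simps)

text \<open>Half the difference of two zero-one values lies in \<open>{-1/2, 0, 1/2}\<close>, and a Rademacher sum of small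
  variance cannot stay close to this set, since its fourth moment would be too large.\<close>

lemma rademacher_boolean_error:
  fixes f :: "'i set \<Rightarrow> real" and d :: "'i \<Rightarrow> real"
  assumes I: "finite I" "T \<subseteq> I" and f: "\<And>\<eta>. f \<eta> = 0 \<or> f \<eta> = 1"
  defines "\<tau> \<equiv> \<Sum>s\<in>T. (d s)\<^sup>2"
  shows "2 ^ card I * (\<tau> * (1 / 8 - 3 * \<tau>)) \<le> (\<Sum>\<eta>\<in>Pow I. (f \<eta> - b - rademacher_sum d I \<eta>)\<^sup>2)"
proof -
  define d' where "d' s = (if s \<in> T then d s else 0)" for s
  define Y where "Y = rademacher_sum d' I"
  define e where "e \<eta> = f \<eta> - b - rademacher_sum d I \<eta>" for \<eta>
  have \<tau>: "(\<Sum>s\<in>I. (d' s)\<^sup>2) = \<tau>"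
  proof -
    have "(\<Sum>s\<in>I. (d' s)\<^sup>2) = (\<Sum>s\<in>I. if s \<in> T then (d s)\<^sup>2 else 0)" by (intro sum.cong) (auto simp: d'_def)
    also have "\<dots> = \<tau>" using I by (simp add: \<tau>_def sum.inter_restrict[symmetric] Int_absorb1)
    finally show ?thesis .
  qed
  \<comment> \<open>Half the difference between a point and its flip on \<open>T\<close> removes
    \<open>b\<close> and all coordinates outside \<open>T\<close>, leaving a Rademacher sum of
    variance \<open>\<tau>\<close>.\<close>
  have "(Y \<eta>)\<^sup>2 / 8 - ((e \<eta>)\<^sup>2 + (e (sym_diff \<eta> T))\<^sup>2) / 2 \<le> (Y \<eta>) ^ 4" for \<eta>
  proof -
    define z where "z = (f \<eta> - f (sym_diff \<eta> T)) / 2"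
    have "z = 0 \<or> z = 1 / 2 \<or> z = - 1 / 2" using f[of \<eta>] f[of "sym_diff \<eta> T"] by (auto simp: z_def)
    then have "(Y \<eta>)\<^sup>2 / 8 - (Y \<eta> - z)\<^sup>2 \<le> (Y \<eta>) ^ 4" by (rule quartic_bound)
    moreover have "rademacher_sum d I \<eta> - rademacher_sum d I (sym_diff \<eta> T) = 2 * Y \<eta>"
      using rademacher_flip[OF I, of d \<eta>] unfolding Y_def d'_def[abs_def] .
    then have "Y \<eta> - z = (e (sym_diff \<eta> T) - e \<eta>) / 2" by (simp add: z_def e_def field_simps)
    then have "(Y \<eta> - z)\<^sup>2 \<le> ((e (sym_diff \<eta> T))\<^sup>2 + (e \<eta>)\<^sup>2) / 2" by (simp only: half_diff_square_le)
    ultimately show ?thesis by argo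
  qed
  then have "(\<Sum>\<eta>\<in>Pow I. (Y \<eta>)\<^sup>2 / 8 - ((e \<eta>)\<^sup>2 + (e (sym_diff \<eta> T))\<^sup>2) / 2) \<le> (\<Sum>\<eta>\<in>Pow I. (Y \<eta>) ^ 4)"
    by (intro sum_mono)
  also have "\<dots> \<le> 2 ^ card I * (3 * \<tau>\<^sup>2)"
    using rademacher_moments(2)[OF I(1), of d'] by (simp add: Y_def \<tau>)
  finally have "(\<Sum>\<eta>\<in>Pow I. (Y \<eta>)\<^sup>2) / 8 - (\<Sum>\<eta>\<in>Pow I. (e \<eta>)\<^sup>2) \<le> 2 ^ card I * (3 * \<tau>\<^sup>2)"
    by (simp add: sum_subtractf sum_divide_distrib[symmetric] sum.distrib sum_Pow_flip[OF I(2), of "\<lambda>\<eta>. (e \<eta>)\<^sup>2"])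
  moreover have "(\<Sum>\<eta>\<in>Pow I. (Y \<eta>)\<^sup>2) = 2 ^ card I * \<tau>"
    using rademacher_moments(1)[OF I(1), of d'] by (simp add: Y_def \<tau>)
  ultimately show ?thesis by (simp add: e_def power2_eq_square algebra_simps)
qed

lemma subset_sum_between:
  fixes w :: "'i \<Rightarrow> real"
  assumes "finite I" "\<And>s. s \<in> I \<Longrightarrow> w s \<le> \<delta>" "0 \<le> c" "c < sum w I"
  obtains T where "T \<subseteq> I" "sum w T \<le> c" "c - \<delta> \<le> sum w T"
proof -
  have "\<exists>T\<subseteq>I. sum w T \<le> c \<and> c - \<delta> \<le> sum w T" using assms
  proof (induction I)
    case (insert t I)
    show ?case
    proof (cases "c < sum w I")
      case True
      then show ?thesis using insert by (meson insertI2 subset_insertI2)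
    next
      case False
      have "w t \<le> \<delta>" "c < w t + sum w I" using insert.hyps insert.prems by auto
      then show ?thesis using False by (intro exI[of _ I]) auto
    qed
  qed simp
  then show ?thesis using that by blast
qed

text \<open>For variance up to 1/48 the factor \<open>1 / 8 - 3 * \<tau>\<close> is at least 1/16,
  and \<open>T = I\<close> suffices. Beyond that, smallness of the coefficients provides a
  \<open>T\<close> of variance just below 1/48, so the mean error is at least 1/800; the variance is
  bounded by a constant plus twice the mean error, and the constant is absorbed.\<close>

theorem rademacher_variance_le_error:
  fixes f :: "'i set \<Rightarrow> real"
  assumes I: "finite I" and f: "\<And>\<eta>. f \<eta> = 0 \<or> f \<eta> = 1"
    and small: "\<And>s. s \<in> I \<Longrightarrow> (d s)\<^sup>2 \<le> 1 / 2000"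
  shows "2 ^ card I * (\<Sum>s\<in>I. (d s)\<^sup>2) \<le> 1000 * (\<Sum>\<eta>\<in>Pow I. (f \<eta> - b - rademacher_sum d I \<eta>)\<^sup>2)"
    (is "2 ^ card I * ?\<sigma> \<le> 1000 * ?err")
proof (cases "?\<sigma> \<le> 1 / 48")
  case True
  have s0: "0 \<le> ?\<sigma>" by (simp add: sum_nonneg)
  have "?\<sigma> * (1 / 16) \<le> ?\<sigma> * (1 / 8 - 3 * ?\<sigma>)" using True s0 by (intro mult_left_mono) auto
  then have "2 ^ card I * (?\<sigma> * (1 / 16)) \<le> 2 ^ card I * (?\<sigma> * (1 / 8 - 3 * ?\<sigma>))" by (rule mult_left_mono) simp
  also have "\<dots> \<le> ?err" using rademacher_boolean_error[OF I order_refl f] .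
  finally have "2 ^ card I * ?\<sigma> \<le> 16 * ?err" by simp
  moreover have "0 \<le> ?err" by (simp add: sum_nonneg)
  ultimately show ?thesis by linarith
next
  case False
  obtain T where T: "T \<subseteq> I" "(\<Sum>s\<in>T. (d s)\<^sup>2) \<le> 1 / 48" "1 / 48 - 1 / 2000 \<le> (\<Sum>s\<in>T. (d s)\<^sup>2)"
    using subset_sum_between[OF I, of "\<lambda>s. (d s)\<^sup>2" "1 / 2000" "1 / 48"] small False by auto
  have "(1 / 50) * (1 / 16) \<le> (\<Sum>s\<in>T. (d s)\<^sup>2) * (1 / 8 - 3 * (\<Sum>s\<in>T. (d s)\<^sup>2))"
    using T by (intro mult_mono) auto
  then have "2 ^ card I * ((1 / 50) * (1 / 16)) \<le> 2 ^ card I * ((\<Sum>s\<in>T. (d s)\<^sup>2) * (1 / 8 - 3 * (\<Sum>s\<in>T. (d s)\<^sup>2)))"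
    by (rule mult_left_mono) simp
  also have "\<dots> \<le> ?err" using rademacher_boolean_error[OF I T(1) f] .
  finally have e: "2 ^ card I \<le> 800 * ?err" by simp
  \<comment> \<open>Centering at 1/2 makes \<open>f - 1/2\<close> of constant square 1/4, so the
    variance is at most twice the mean error plus 1/2.\<close>
  define X where "X \<eta> = b + rademacher_sum d I \<eta> - 1 / 2" for \<eta>
  have "(rademacher_sum d I \<eta>)\<^sup>2 \<le> ((X \<eta>)\<^sup>2 + (X (sym_diff \<eta> I))\<^sup>2) / 2" for \<eta>
  proof -
    have "rademacher_sum (\<lambda>s. if s \<in> I then d s else 0) I \<eta> = rademacher_sum d I \<eta>"
      unfolding rademacher_sum_def by (intro sum.cong) auto
    then have "rademacher_sum d I \<eta> = (X \<eta> - X (sym_diff \<eta> I)) / 2"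
      using rademacher_flip[OF I order_refl, of d \<eta>] by (simp add: X_def)
    then show ?thesis using half_diff_square_le by metis
  qed
  then have "(\<Sum>\<eta>\<in>Pow I. (rademacher_sum d I \<eta>)\<^sup>2) \<le> (\<Sum>\<eta>\<in>Pow I. ((X \<eta>)\<^sup>2 + (X (sym_diff \<eta> I))\<^sup>2) / 2)" by (intro sum_mono)
  also have "\<dots> = (\<Sum>\<eta>\<in>Pow I. (X \<eta>)\<^sup>2)"
    by (simp add: sum_divide_distrib[symmetric] sum.distrib sum_Pow_flip[OF order_refl, of "\<lambda>\<eta>. (X \<eta>)\<^sup>2"])
  also have "\<dots> \<le> (\<Sum>\<eta>\<in>Pow I. 2 * (f \<eta> - b - rademacher_sum d I \<eta>)\<^sup>2 + 1 / 2)"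
  proof (rule sum_mono)
    fix \<eta>
    define e where "e = f \<eta> - b - rademacher_sum d I \<eta>"
    have X: "X \<eta> = f \<eta> - 1 / 2 - e" by (simp add: X_def e_def)
    have "0 \<le> (f \<eta> - 1 / 2 + e)\<^sup>2" by simp
    then show "(X \<eta>)\<^sup>2 \<le> 2 * (f \<eta> - b - rademacher_sum d I \<eta>)\<^sup>2 + 1 / 2"
      using f[of \<eta>] unfolding X e_def[symmetric] by (auto simp: power2_eq_square algebra_simps)
  qed
  also have "\<dots> = 2 * ?err + 2 ^ card I / 2" using I by (simp add: sum.distrib sum_distrib_left card_Pow)
  finally have "2 ^ card I * ?\<sigma> \<le> 2 * ?err + 2 ^ card I / 2" using rademacher_moments(1)[OF I] by simp
  moreover have "0 \<le> ?err" by (simp add: sum_nonneg)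
  ultimately show ?thesis using e by linarith
qed

section \<open>Stability\<close>

lemma permutes_image_exists:
  assumes "finite V" "Q \<in> nsets V k" "Q' \<in> nsets V k"
  obtains p where "p permutes V" "p ` Q = Q'"
proof -
  have fin: "finite Q" "finite Q'" "card Q = card Q'" "Q \<subseteq> V" "Q' \<subseteq> V" using assms by (auto simp: nsets_def)
  obtain f where f: "bij_betw f Q Q'" using fin finite_same_card_bij by blast
  have "card (V - Q) = card (V - Q')" using fin by (simp add: card_Diff_subset)
  then obtain g where g: "bij_betw g (V - Q) (V - Q')" using assms finite_same_card_bij by (metis finite_Diff)
  define p where "p x = (if x \<in> Q then f x else if x \<in> V then g x else x)" for x
  have 1: "bij_betw p Q Q'" using f by (subst bij_betw_cong[of _ _ f]) (auto simp: p_def)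
  have 2: "bij_betw p (V - Q) (V - Q')" using g by (subst bij_betw_cong[of _ _ g]) (auto simp: p_def)
  have "bij_betw p (Q \<union> (V - Q)) (Q' \<union> (V - Q'))" using 1 2 by (rule bij_betw_combine) auto
  then have "bij_betw p V V" using fin by (simp add: Un_absorb1)
  then have "p permutes V" by (rule bij_imp_permutes) (use fin in \<open>auto simp: p_def\<close>)
  moreover have "p ` Q = Q'" using 1 by (simp add: bij_betw_def)
  ultimately show ?thesis by (rule that)
qed

text \<open>Composing with a fixed permutation shows that the sum does not depend on
  \<open>Q\<close>: a random image of a fixed k-set is uniform.\<close>

lemma sum_permutations_image:
  fixes G :: "'a set \<Rightarrow> real"
  assumes V: "finite V" and Q: "Q \<in> nsets V k"
  shows "real (card V choose k) * (\<Sum>p | p permutes V. G (p ` Q)) = fact (card V) * (\<Sum>A\<in>nsets V k. G A)"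
proof -
  have const: "(\<Sum>p | p permutes V. G (p ` Q')) = (\<Sum>p | p permutes V. G (p ` Q))" if Q': "Q' \<in> nsets V k" for Q'
  proof -
    obtain q where q: "q permutes V" "q ` Q = Q'" using permutes_image_exists[OF V Q Q'] by metis
    have "(\<Sum>p | p permutes V. G (p ` Q)) = (\<Sum>p | p permutes V. G ((p \<circ> q) ` Q))"
      by (rule sum_permutations_compose_right[OF q(1)])
    then show ?thesis by (simp only: image_comp[symmetric] q(2))
  qed
  have "real (card V choose k) * (\<Sum>p | p permutes V. G (p ` Q)) = (\<Sum>Q'\<in>nsets V k. \<Sum>p | p permutes V. G (p ` Q))"
    by simp
  also have "\<dots> = (\<Sum>Q'\<in>nsets V k. \<Sum>p | p permutes V. G (p ` Q'))" by (intro sum.cong refl const[symmetric])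
  also have "\<dots> = (\<Sum>p | p permutes V. \<Sum>Q'\<in>nsets V k. G (p ` Q'))" by (rule sum.swap)
  also have "\<dots> = (\<Sum>p | p permutes V. \<Sum>A\<in>nsets V k. G A)"
  proof (rule sum.cong[OF refl])
    fix p assume "p \<in> {p. p permutes V}"
    then have "bij_betw p V V" by (simp add: permutes_imp_bij)
    then have "bij_betw ((`) p) (nsets V k) (nsets V k)" by (rule bij_betw_nsets)
    then show "(\<Sum>Q'\<in>nsets V k. G (p ` Q')) = (\<Sum>A\<in>nsets V k. G A)" by (rule sum.reindex_bij_betw)
  qed
  also have "\<dots> = fact (card V) * (\<Sum>A\<in>nsets V k. G A)" using V by (simp add: card_permutations)
  finally show ?thesis .
qed

lemma half_binomial: "2 * r \<le> M \<Longrightarrow> 0 < M \<Longrightarrow> M choose r \<le> 2 * ((M - 1) choose r)"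
proof -
  assume r: "2 * r \<le> M" "0 < M"
  have "M * (M choose r) \<le> (2 * (M - r)) * (M choose r)" using r by (intro mult_right_mono) auto
  also have "\<dots> = M * (2 * ((M - 1) choose r))" using binomial_absorb_comp[of M r] by simp
  finally show ?thesis using r by simp
qed

section \<open>From a close affine function to a star\<close>

locale near_affine =
  fixes n k :: nat and \<A> :: "nat set set" and m c :: real and \<phi> :: "nat \<Rightarrow> real"
  assumes k: "0 < k" "2 * k < n"
    and A: "\<A> \<subseteq> nsets {1..n} k" "intersecting \<A>" "\<A> \<noteq> {}"
    and card_le: "card \<A> \<le> (n - 1) choose (k - 1)"
    and c: "0 \<le> c" "c \<le> 1 / 10 ^ 12"
    and err_le: "(\<Sum>A\<in>nsets {1..n} k. (of_bool (A \<in> \<A>) - m - (\<Sum>i\<in>A. \<phi> i))\<^sup>2) \<le> c * real (card \<A>)"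
begin

definition f :: "nat set \<Rightarrow> real" where "f A = of_bool (A \<in> \<A>)"

definition e :: "nat set \<Rightarrow> real" where "e A = f A - m - (\<Sum>i\<in>A. \<phi> i)"

abbreviation N :: real where "N \<equiv> real ((n - 1) choose (k - 1))"

lemma finite_A: "finite \<A>"
  using A(1) by (meson finite_atLeastAtMost finite_imp_finite_nsets finite_subset)

lemma card_pos: "0 < card \<A>"
  using A(3) finite_A by (simp add: card_gt_0_iff)

lemma err: "(\<Sum>A\<in>nsets {1..n} k. (e A)\<^sup>2) \<le> c * real (card \<A>)"
  using err_le by (simp add: e_def f_def)

lemma err_N: "(\<Sum>A\<in>nsets {1..n} k. (e A)\<^sup>2) \<le> c * N"
  using err c(1) card_le by (meson mult_left_mono of_nat_mono order_trans)

lemma N_pos: "0 < N"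
  using k by simp

lemma cN_le: "c * N \<le> N / 1000000000000"
  using mult_right_mono[OF c(2), of N] by simp

text \<open>If the coefficients are nearly equal, then on the cube of transversals of \<open>k\<close> disjoint pairs the affine
  function is a Rademacher sum with small coefficients, so its variance is at most the error. But opposite
  transversals are disjoint, hence not both in the family, which makes the variance large.\<close>

lemma coefficients_not_close: "\<exists>i\<in>{1..n}. \<exists>j\<in>{1..n}. 1 / 500 < (\<phi> i - \<phi> j)\<^sup>2"
proof (rule ccontr)
  assume "\<not> ?thesis"
  then have close: "(\<phi> i - \<phi> j)\<^sup>2 \<le> 1 / 500" if "i \<in> {1..n}" "j \<in> {1..n}" for i j
    using that by (meson not_le)
  define V where "V = {1..n}"
  define I where "I = {1..k}"
  define Q where "Q \<eta> = (\<lambda>s. if s \<in> \<eta> then k + s else s) ` I" for \<eta>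
  have injQ: "inj_on (\<lambda>s. if s \<in> \<eta> then k + s else s) I" for \<eta>
    by (intro inj_onI) (auto simp: I_def split: if_splits)
  have V: "finite V" "card V = n" by (auto simp: V_def)
  have I: "finite I" "card I = k" by (auto simp: I_def)
  have Q: "Q \<eta> \<in> nsets V k" for \<eta>
  proof -
    have "Q \<eta> \<subseteq> V" using k by (auto simp: Q_def V_def I_def)
    moreover have "card (Q \<eta>) = k" unfolding Q_def by (simp only: card_image[OF injQ] I)
    ultimately show ?thesis using V finite_subset by (auto simp: nsets_def)
  qed
  have disj: "Q \<eta> \<inter> Q (sym_diff \<eta> I) = {}" for \<eta>
    by (auto simp: Q_def I_def split: if_splits)
  \<comment> \<open>The constant is \<open>4 + 4 * 1000\<close>: error and variance enter with
    factor 4, and \<open>rademacher_variance_le_error\<close> bounds the variance by 1000 times the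
    error.\<close>
  have per: "(\<Sum>\<eta>\<in>Pow I. f (p ` Q \<eta>)) \<le> 4004 * (\<Sum>\<eta>\<in>Pow I. (e (p ` Q \<eta>))\<^sup>2)" if p: "p permutes V" for p
  proof -
    define d where "d s = (\<phi> (p s) - \<phi> (p (k + s))) / 2" for s
    define b where "b = m + (\<Sum>s\<in>I. (\<phi> (p s) + \<phi> (p (k + s))) / 2)"
    have inj: "inj_on p S" for S using p by (meson inj_on_subset permutes_inj subset_UNIV)
    have eq: "e (p ` Q \<eta>) = f (p ` Q \<eta>) - b - rademacher_sum d I \<eta>" for \<eta>
    proof -
      have "(\<Sum>i\<in>p ` Q \<eta>. \<phi> i) = (\<Sum>s\<in>I. \<phi> (p (if s \<in> \<eta> then k + s else s)))"
        unfolding Q_def by (simp only: sum.reindex[OF inj] sum.reindex[OF injQ] o_def)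
      also have "\<dots> = (\<Sum>s\<in>I. (\<phi> (p s) + \<phi> (p (k + s))) / 2 + (if s \<in> \<eta> then - d s else d s))"
        by (intro sum.cong) (auto simp: d_def field_simps)
      also have "\<dots> = b - m + rademacher_sum d I \<eta>"
        by (simp add: b_def rademacher_sum_def sum.distrib)
      finally show ?thesis by (simp add: e_def)
    qed
    have pV: "p s \<in> {1..n}" "p (k + s) \<in> {1..n}" if "s \<in> I" for s
      using that k permutes_in_image[OF p] by (auto simp: I_def V_def)
    have "2 ^ card I * (\<Sum>s\<in>I. (d s)\<^sup>2) \<le> 1000 * (\<Sum>\<eta>\<in>Pow I. (f (p ` Q \<eta>) - b - rademacher_sum d I \<eta>)\<^sup>2)"
    proof (rule rademacher_variance_le_error[OF I(1)])
      show "f (p ` Q \<eta>) = 0 \<or> f (p ` Q \<eta>) = 1" for \<eta> by (simp add: f_def)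
      \<comment> \<open>The half in \<open>d\<close> turns 1/500 into 1/2000.\<close>
      show "(d s)\<^sup>2 \<le> 1 / 2000" if "s \<in> I" for s
        using close[OF pV[OF that]] by (simp add: d_def power_divide)
    qed
    then have var: "2 ^ card I * (\<Sum>s\<in>I. (d s)\<^sup>2) \<le> 1000 * (\<Sum>\<eta>\<in>Pow I. (e (p ` Q \<eta>))\<^sup>2)"
      by (simp add: eq)
    define F where "F \<eta> = f (p ` Q \<eta>)" for \<eta>
    define E where "E \<eta> = e (p ` Q \<eta>)" for \<eta>
    have "F \<eta> + F (sym_diff \<eta> I) \<le> 4 * ((E \<eta>)\<^sup>2 + (E (sym_diff \<eta> I))\<^sup>2) + 8 * (rademacher_sum d I \<eta>)\<^sup>2" for \<eta>
    proof -
      define F1 F2 E1 E2 R where "F1 = F \<eta>" and "F2 = F (sym_diff \<eta> I)" and "E1 = E \<eta>" and "E2 = E (sym_diff \<eta> I)"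
        and "R = rademacher_sum d I \<eta>"
      have "p ` Q \<eta> \<inter> p ` Q (sym_diff \<eta> I) = {}"
        using disj inj[of UNIV] by (metis image_Int image_empty)
      then have "F1 = 0 \<or> F2 = 0" using A(2) by (auto simp: F1_def F2_def F_def f_def intersecting_def)
      then have "F1 + F2 = (F1 - F2)\<^sup>2" by (auto simp: F1_def F2_def F_def f_def)
      also have "F1 - F2 = (E1 - E2) + 2 * R"
      proof -
        have "rademacher_sum (\<lambda>s. if s \<in> I then d s else 0) I \<eta> = R"
          unfolding rademacher_sum_def R_def by (intro sum.cong) auto
        then have "rademacher_sum d I \<eta> - rademacher_sum d I (sym_diff \<eta> I) = 2 * R"
          using rademacher_flip[OF I(1) order_refl, of d \<eta>] by simp
        then show ?thesis by (simp add: F1_def F2_def E1_def E2_def F_def E_def eq)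
      qed
      also have "((E1 - E2) + 2 * R)\<^sup>2 \<le> 4 * (E1\<^sup>2 + E2\<^sup>2) + 8 * R\<^sup>2"
      proof -
        have "0 \<le> (E1 - E2 - 2 * R)\<^sup>2 + 2 * (E1 + E2)\<^sup>2" by simp
        then show ?thesis by (simp add: power2_eq_square algebra_simps)
      qed
      finally show ?thesis by (simp add: F1_def F2_def E1_def E2_def R_def)
    qed
    then have "(\<Sum>\<eta>\<in>Pow I. F \<eta> + F (sym_diff \<eta> I)) \<le> 
      (\<Sum>\<eta>\<in>Pow I. 4 * ((E \<eta>)\<^sup>2 + (E (sym_diff \<eta> I))\<^sup>2) + 8 * (rademacher_sum d I \<eta>)\<^sup>2)"
      by (intro sum_mono)
    then have "2 * (\<Sum>\<eta>\<in>Pow I. F \<eta>) \<le> 8 * (\<Sum>\<eta>\<in>Pow I. (E \<eta>)\<^sup>2) + 8 * (\<Sum>\<eta>\<in>Pow I. (rademacher_sum d I \<eta>)\<^sup>2)"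
      by (simp add: sum.distrib sum_distrib_left[symmetric] sum_Pow_flip[OF order_refl, of "\<lambda>\<eta>. (E \<eta>)\<^sup>2"]
        sum_Pow_flip[OF order_refl, of F])
    then show ?thesis using var by (simp add: rademacher_moments(1)[OF I(1)] F_def E_def)
  qed
  define \<kappa> :: real where "\<kappa> = fact n / real (n choose k)"
  have \<kappa>: "0 < \<kappa>" using k by (simp add: \<kappa>_def)
  have avg: "(\<Sum>p | p permutes V. \<Sum>\<eta>\<in>Pow I. G (p ` Q \<eta>)) = 2 ^ k * (\<kappa> * (\<Sum>A\<in>nsets V k. G A))" for G :: "nat set \<Rightarrow> real"
  proof -
    have "(\<Sum>p | p permutes V. \<Sum>\<eta>\<in>Pow I. G (p ` Q \<eta>)) = (\<Sum>\<eta>\<in>Pow I. \<Sum>p | p permutes V. G (p ` Q \<eta>))"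
      by (rule sum.swap)
    also have "\<dots> = (\<Sum>\<eta>\<in>Pow I. \<kappa> * (\<Sum>A\<in>nsets V k. G A))"
    proof (rule sum.cong[OF refl])
      fix \<eta>
      have "0 < real (n choose k)" using k by simp
      then show "(\<Sum>p | p permutes V. G (p ` Q \<eta>)) = \<kappa> * (\<Sum>A\<in>nsets V k. G A)"
        using sum_permutations_image[OF V(1) Q[of \<eta>], of G] V(2) by (simp add: \<kappa>_def field_simps)
    qed
    also have "\<dots> = 2 ^ k * (\<kappa> * (\<Sum>A\<in>nsets V k. G A))" using I by (simp add: card_Pow)
    finally show ?thesis .
  qed
  have "(\<Sum>p | p permutes V. \<Sum>\<eta>\<in>Pow I. f (p ` Q \<eta>)) \<le> (\<Sum>p | p permutes V. 4004 * (\<Sum>\<eta>\<in>Pow I. (e (p ` Q \<eta>))\<^sup>2))"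
    using per by (intro sum_mono) auto
  also have "\<dots> = 4004 * (\<Sum>p | p permutes V. \<Sum>\<eta>\<in>Pow I. (e (p ` Q \<eta>))\<^sup>2)" by (rule sum_distrib_left[symmetric])
  finally have "2 ^ k * (\<kappa> * (\<Sum>A\<in>nsets V k. f A)) \<le> 4004 * (2 ^ k * (\<kappa> * (\<Sum>A\<in>nsets V k. (e A)\<^sup>2)))"
    unfolding avg avg[of "\<lambda>A. (e A)\<^sup>2"] .
  then have "2 ^ k * \<kappa> * (\<Sum>A\<in>nsets V k. f A) \<le> 2 ^ k * \<kappa> * (4004 * (\<Sum>A\<in>nsets V k. (e A)\<^sup>2))"
    by (simp add: mult_ac)
  then have "(\<Sum>A\<in>nsets V k. f A) \<le> 4004 * (\<Sum>A\<in>nsets V k. (e A)\<^sup>2)"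
    using \<kappa> by (subst (asm) mult_le_cancel_left_pos) auto
  moreover have "(\<Sum>A\<in>nsets V k. f A) = card \<A>"
    using A(1) V by (simp add: f_def V_def finite_imp_finite_nsets Int_absorb1 sum_of_bool_eq)
  ultimately have "card \<A> \<le> 4004 * (c * real (card \<A>))" using err by (simp add: V_def)
  also have "\<dots> \<le> 4004 * (1 / 10 ^ 12 * real (card \<A>))" using c by (intro mult_left_mono mult_right_mono) auto
  finally show False using card_pos by simp
qed

text \<open>Exchanging \<open>i\<close> for \<open>j\<close> changes the affine function by \<open>\<phi> i - \<phi> j\<close> and the indicator by an integer.\<close>

lemma exchange_error:
  assumes ij: "i \<in> {1..n}" "j \<in> {1..n}" and S: "S \<subseteq> {A \<in> nsets {1..n} k. i \<in> A \<and> j \<notin> A}"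
    and t: "\<And>A. A \<in> S \<Longrightarrow> t \<le> (\<phi> i - \<phi> j - (f A - f (insert j (A - {i}))))\<^sup>2"
  shows "t * card S \<le> 2 * (c * N)"
proof -
  define g where "g A = insert j (A - {i})" for A
  have fin: "finite (nsets {1..n} k)" by (simp add: finite_imp_finite_nsets)
  have finS: "finite S" using S fin by (auto intro: finite_subset)
  have S': "A \<in> nsets {1..n} k" "i \<in> A" "j \<notin> A" "finite A" if "A \<in> S" for A using that S by (auto simp: nsets_def)
  have g: "g A \<in> nsets {1..n} k" "i \<notin> g A" if "A \<in> S" for A
    using S'[OF that] ij card_Suc_Diff1[of A i] by (auto simp: g_def nsets_def)
  have inj: "inj_on g S"
  proof (rule inj_onI)
    fix A B assume AB: "A \<in> S" "B \<in> S" "g A = g B"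
    have "A = insert i (g A - {j})" "B = insert i (g B - {j})" using S'[OF AB(1)] S'[OF AB(2)] by (auto simp: g_def)
    then show "A = B" using AB by simp
  qed
  have "t * card S = (\<Sum>A\<in>S. t)" by simp
  also have "\<dots> \<le> (\<Sum>A\<in>S. 2 * (e A)\<^sup>2 + 2 * (e (g A))\<^sup>2)"
  proof (rule sum_mono)
    fix A assume A: "A \<in> S"
    have "(\<Sum>l\<in>g A. \<phi> l) = \<phi> j + (\<Sum>l\<in>A - {i}. \<phi> l)" using S'[OF A] by (simp add: g_def)
    moreover have "(\<Sum>l\<in>A. \<phi> l) = \<phi> i + (\<Sum>l\<in>A - {i}. \<phi> l)" using S'[OF A] by (simp add: sum.remove)
    ultimately have "\<phi> i - \<phi> j - (f A - f (g A)) = e (g A) - e A" by (simp add: e_def)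
    then have "t \<le> (e (g A) - e A)\<^sup>2" using t[OF A] by (simp add: g_def)
    moreover have "0 \<le> (e A + e (g A))\<^sup>2" by simp
    ultimately show "t \<le> 2 * (e A)\<^sup>2 + 2 * (e (g A))\<^sup>2" by (simp add: power2_eq_square algebra_simps)
  qed
  also have "\<dots> = 2 * ((\<Sum>A\<in>S. (e A)\<^sup>2) + (\<Sum>A\<in>g ` S. (e A)\<^sup>2))"
    using inj by (simp add: sum.distrib sum_distrib_left sum.reindex)
  \<comment> \<open>Sets of \<open>S\<close> contain \<open>i\<close> and their images do not, so
    the error of each k-set is used at most once.\<close>
  also have "(\<Sum>A\<in>S. (e A)\<^sup>2) + (\<Sum>A\<in>g ` S. (e A)\<^sup>2) = (\<Sum>A\<in>S \<union> g ` S. (e A)\<^sup>2)"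
  proof (rule sum.union_disjoint[symmetric])
    show "S \<inter> g ` S = {}" using S'(2) g(2) by blast
  qed (use finS in auto)
  also have "\<dots> \<le> (\<Sum>A\<in>nsets {1..n} k. (e A)\<^sup>2)"
    using fin S' g by (intro sum_mono2) auto
  also have "\<dots> \<le> c * N" by (rule err_N)
  finally show ?thesis by simp
qed

lemma card_containing_avoiding:
  assumes "i \<in> {1..n}" "D \<subseteq> {1..n}" "i \<notin> D"
  shows "card {A \<in> nsets {1..n} k. i \<in> A \<and> A \<inter> D = {}} = (n - 1 - card D) choose (k - 1)"
proof -
  have fD: "finite D" using assms finite_subset by blast
  have "{A \<in> nsets {1..n} k. i \<in> A \<and> A \<inter> D = {}} = {A \<in> nsets ({1..n} - D) k. {i} \<subseteq> A}"
    by (auto simp: nsets_def)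
  moreover have "card ({1..n} - D) = n - card D" using assms fD by (simp add: card_Diff_subset)
  ultimately show ?thesis using assms k card_nsets_superset[of "{1..n} - D" "{i}" k] by simp
qed

text \<open>Otherwise every exchange costs at least 10^-8, and at least half of the \<open>N\<close>
  sets through \<open>i\<close> avoid \<open>j\<close>; this exceeds
  \<open>2 * c * N\<close>.\<close>

lemma coefficients_near_integer:
  assumes ij: "i \<in> {1..n}" "j \<in> {1..n}" "i \<noteq> j"
  obtains v :: real where "v \<in> {-1, 0, 1}" "\<bar>\<phi> i - \<phi> j - v\<bar> < 1 / 10 ^ 4"
proof (rule ccontr)
  assume "\<not> thesis"
  then have far: "1 / 10 ^ 4 \<le> \<bar>\<phi> i - \<phi> j - v\<bar>" if "v \<in> {-1, 0, 1}" for v using that \<open>\<And>v. _ \<Longrightarrow> _ \<Longrightarrow> thesis\<close> by (meson not_le)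
  define S where "S = {A \<in> nsets {1..n} k. i \<in> A \<and> j \<notin> A}"
  have "1 / 100000000 * real (card S) \<le> 2 * (c * N)"
  proof (rule exchange_error[OF ij(1,2)])
    show "S \<subseteq> {A \<in> nsets {1..n} k. i \<in> A \<and> j \<notin> A}" by (simp add: S_def)
    fix A
    have "f A - f (insert j (A - {i})) \<in> {-1, 0, 1}" by (auto simp: f_def)
    then have "\<bar>1 / 10 ^ 4\<bar> \<le> \<bar>\<phi> i - \<phi> j - (f A - f (insert j (A - {i})))\<bar>" using far by fastforce
    then have "(1 / 10 ^ 4)\<^sup>2 \<le> (\<phi> i - \<phi> j - (f A - f (insert j (A - {i}))))\<^sup>2" by (rule power2_le_iff_abs_le[THEN iffD2, rotated, OF order_refl, THEN order_trans, rotated] | simp add: abs_le_square_iff[symmetric])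
    then show "1 / 100000000 \<le> (\<phi> i - \<phi> j - (f A - f (insert j (A - {i}))))\<^sup>2" by (simp add: power_divide)
  qed
  moreover have "real (card S) = real ((n - 2) choose (k - 1))"
    using card_containing_avoiding[of i "{j}"] ij by (simp add: S_def numeral_2_eq_2)
  moreover have "(n - 1) choose (k - 1) \<le> 2 * ((n - 2) choose (k - 1))"
    using half_binomial[of "k - 1" "n - 1"] k by (simp add: numeral_2_eq_2)
  then have "N \<le> 2 * real ((n - 2) choose (k - 1))" by linarith
  ultimately show False using N_pos cN_le by linarith
qed

text \<open>On a set outside the family the indicator cannot drop under the exchange, while the
  affine function drops by nearly 1. So each such set costs nearly 1, and 2/0.9 is rounded up to
  3.\<close>

lemma card_missing_le:
  assumes ij: "i \<in> {1..n}" "j \<in> {1..n}" and d: "\<bar>\<phi> i - \<phi> j - 1\<bar> < 1 / 10 ^ 4"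
  shows "real (card {A \<in> nsets {1..n} k. i \<in> A \<and> j \<notin> A \<and> A \<notin> \<A>}) \<le> 3 * (c * N)"
proof -
  have "9 / 10 * real (card {A \<in> nsets {1..n} k. i \<in> A \<and> j \<notin> A \<and> A \<notin> \<A>}) \<le> 2 * (c * N)"
  proof (rule exchange_error[OF ij])
    fix A assume "A \<in> {A \<in> nsets {1..n} k. i \<in> A \<and> j \<notin> A \<and> A \<notin> \<A>}"
    then have fA: "f A = 0" by (simp add: f_def)
    have "0 \<le> f (insert j (A - {i}))" by (simp add: f_def)
    moreover have "- (\<phi> i - \<phi> j - 1) < 1 / 10 ^ 4" using d by (simp only: abs_less_iff)
    then have "99 / 100 \<le> \<phi> i - \<phi> j" by simp
    ultimately have "99 / 100 \<le> \<phi> i - \<phi> j - (f A - f (insert j (A - {i})))" using fA by simp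
    then have "(99 / 100)\<^sup>2 \<le> (\<phi> i - \<phi> j - (f A - f (insert j (A - {i}))))\<^sup>2" by (rule power_mono) simp
    then show "9 / 10 \<le> (\<phi> i - \<phi> j - (f A - f (insert j (A - {i}))))\<^sup>2" by (simp add: power_divide)
  qed auto
  moreover have "0 \<le> c * N" using c N_pos by simp
  ultimately show ?thesis by linarith
qed

text \<open>Take disjoint (k-1)-sets \<open>A\<close> and \<open>A'\<close> avoiding
  \<open>i\<close>, \<open>j\<close>, \<open>l\<close>: \<open>insert i A\<close> and
  \<open>insert j A'\<close> are disjoint, so one of them is missing from the family. Disjointness
  is a regular relation of positive degree \<open>R\<close>, so by double counting at least as many
  sets are missing as there are (k-1)-sets in \<open>Y\<close>, at least
  \<open>N / 4\<close>.\<close>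

lemma not_two_high:
  assumes ij: "i \<in> {1..n}" "j \<in> {1..n}" "l \<in> {1..n}" "i \<noteq> j" "i \<noteq> l" "j \<noteq> l"
    and d: "\<bar>\<phi> i - \<phi> l - 1\<bar> < 1 / 10 ^ 4" "\<bar>\<phi> j - \<phi> l - 1\<bar> < 1 / 10 ^ 4"
  shows False
proof -
  define U where "U = {1..n} - {i, j, l}"
  define Y where "Y = nsets U (k - 1)"
  define B where "B x = {A \<in> Y. insert x A \<notin> \<A>}" for x
  have cU: "finite U" "card U = n - 3" using ij by (auto simp: U_def card_Diff_subset)
  have finY: "finite Y" using cU by (simp add: Y_def finite_imp_finite_nsets)
  have B_le: "real (card (B x)) \<le> 3 * (c * N)" if x: "x = i \<or> x = j" for x
  proof -
    have xl: "x \<in> {1..n}" "x \<noteq> l" "\<bar>\<phi> x - \<phi> l - 1\<bar> < 1 / 10 ^ 4" "x \<notin> U" using x ij d by (auto simp: U_def)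
    have "card (B x) = card (insert x ` B x)"
    proof (rule card_image[symmetric], rule inj_onI)
      fix A A' assume "A \<in> B x" "A' \<in> B x" "insert x A = insert x A'"
      moreover have "x \<notin> A''" if "A'' \<in> B x" for A'' using that xl by (auto simp: B_def Y_def nsets_def)
      ultimately show "A = A'" by (metis insert_ident)
    qed
    also have "\<dots> \<le> card {A \<in> nsets {1..n} k. x \<in> A \<and> l \<notin> A \<and> A \<notin> \<A>}"
    proof (rule card_mono)
      show "finite {A \<in> nsets {1..n} k. x \<in> A \<and> l \<notin> A \<and> A \<notin> \<A>}" by (simp add: finite_imp_finite_nsets)
      show "insert x ` B x \<subseteq> {A \<in> nsets {1..n} k. x \<in> A \<and> l \<notin> A \<and> A \<notin> \<A>}"
      proof
        fix A assume "A \<in> insert x ` B x"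
        then obtain A' where A': "A' \<subseteq> U" "finite A'" "card A' = k - 1" "insert x A' \<notin> \<A>" "A = insert x A'"
          by (auto simp: B_def Y_def nsets_def)
        moreover have "x \<notin> A'" using A' xl by auto
        ultimately show "A \<in> {A \<in> nsets {1..n} k. x \<in> A \<and> l \<notin> A \<and> A \<notin> \<A>}"
          using xl k by (auto simp: nsets_def U_def)
      qed
    qed
    finally show ?thesis using card_missing_le[OF xl(1) ij(3) xl(3)] by linarith
  qed
  define R where "R = (n - 3 - (k - 1)) choose (k - 1)"
  have R: "0 < R" using k by (simp add: R_def)
  have reg: "card {A' \<in> Y. A' \<inter> A = {}} = R" if "A \<in> Y" for A
  proof -
    have "{A' \<in> Y. A' \<inter> A = {}} = nsets (U - A) (k - 1)" by (auto simp: Y_def nsets_def)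
    moreover have "card (U - A) = n - 3 - (k - 1)" using that cU by (auto simp: Y_def nsets_def card_Diff_subset)
    ultimately show ?thesis by (simp add: R_def)
  qed
  define P where "P = Sigma Y (\<lambda>A. {A' \<in> Y. A' \<inter> A = {}})"
  define P1 where "P1 = Sigma (B i) (\<lambda>A. {A' \<in> Y. A' \<inter> A = {}})"
  define P2 where "P2 = Sigma (B j) (\<lambda>A. {A' \<in> Y. A' \<inter> A = {}})"
  have BY: "B x \<subseteq> Y" for x by (auto simp: B_def)
  have cP: "card P = card Y * R" unfolding P_def using finY reg by (subst card_SigmaI) auto
  have finB: "finite (B x)" for x using finY BY finite_subset by blast
  have "card P1 = (\<Sum>A\<in>B i. card {A' \<in> Y. A' \<inter> A = {}})" "card P2 = (\<Sum>A\<in>B j. card {A' \<in> Y. A' \<inter> A = {}})"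
    unfolding P1_def P2_def using finY finB by (auto intro!: card_SigmaI)
  then have cP12: "card P1 = card (B i) * R" "card P2 = card (B j) * R"
    using reg BY by (simp_all add: subset_iff)
  have "P \<subseteq> P1 \<union> prod.swap ` P2"
  proof
    fix z assume "z \<in> P"
    then obtain A A' where z: "z = (A, A')" "A \<in> Y" "A' \<in> Y" "A' \<inter> A = {}" by (auto simp: P_def)
    have "insert i A \<inter> insert j A' = {}" using z ij by (auto simp: Y_def U_def nsets_def)
    then have "insert i A \<notin> \<A> \<or> insert j A' \<notin> \<A>" using A(2) unfolding intersecting_def by blast
    then show "z \<in> P1 \<union> prod.swap ` P2"
    proof
      assume "insert i A \<notin> \<A>" then show ?thesis using z by (auto simp: P1_def B_def)
    next
      assume "insert j A' \<notin> \<A>"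
      then have "(A', A) \<in> P2" using z by (auto simp: P2_def B_def)
      then show ?thesis using z(1) by (force simp: image_iff)
    qed
  qed
  moreover have "finite P1" "finite P2" unfolding P1_def P2_def using finB finY by auto
  ultimately have "card P \<le> card (P1 \<union> prod.swap ` P2)" by (intro card_mono) auto
  also have "\<dots> \<le> card P1 + card (prod.swap ` P2)" by (rule card_Un_le)
  also have "\<dots> \<le> card P1 + card P2" using \<open>finite P2\<close> by (intro add_left_mono card_image_le)
  finally have "card P \<le> card P1 + card P2" .
  then have "card Y * R \<le> (card (B i) + card (B j)) * R" unfolding cP cP12 by (simp add: distrib_right)
  then have "card Y \<le> card (B i) + card (B j)" using R by simp
  then have Y: "real (card Y) \<le> 6 * (c * N)" using B_le[of i] B_le[of j] by linarith
  have "n - 1 - 1 = n - 2" "n - 2 - 1 = n - 3" by simp_all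
  then have "(n - 1) choose (k - 1) \<le> 2 * ((n - 2) choose (k - 1))" "(n - 2) choose (k - 1) \<le> 2 * ((n - 3) choose (k - 1))"
    using half_binomial[of "k - 1" "n - 1"] half_binomial[of "k - 1" "n - 2"] k by auto
  then have "(n - 1) choose (k - 1) \<le> 4 * ((n - 3) choose (k - 1))" by linarith
  then have "N \<le> 4 * real (card Y)" using cU by (simp add: Y_def)
  then show False using Y N_pos cN_le by linarith
qed

text \<open>Some rounded difference is 1 or -1; orient it with \<open>a\<close> above
  \<open>b\<close>. For another \<open>l\<close>, the rounded differences from \<open>a\<close> to
  \<open>l\<close> and from \<open>l\<close> to \<open>b\<close> add up to 1, so one of them is 1.
  It is not the second alone, for then \<open>a\<close> and \<open>l\<close> would both lie above
  \<open>b\<close>.\<close>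

lemma high_point:
  obtains i where "i \<in> {1..n}" "\<And>j. j \<in> {1..n} \<Longrightarrow> j \<noteq> i \<Longrightarrow> \<bar>\<phi> i - \<phi> j - 1\<bar> < 1 / 10 ^ 4"
proof -
  obtain i j where ij: "i \<in> {1..n}" "j \<in> {1..n}" "1 / 500 < (\<phi> i - \<phi> j)\<^sup>2" using coefficients_not_close by blast
  then have "i \<noteq> j" by auto
  then obtain v :: real where v: "v \<in> {-1, 0, 1}" "\<bar>\<phi> i - \<phi> j - v\<bar> < 1 / 10 ^ 4"
    using coefficients_near_integer ij by blast
  have "v \<noteq> 0"
  proof
    assume "v = 0"
    then have "\<bar>\<phi> i - \<phi> j\<bar> \<le> 1 / 10 ^ 4" using v by simp
    then have "(\<phi> i - \<phi> j)\<^sup>2 \<le> (1 / 10 ^ 4)\<^sup>2" by (metis abs_ge_zero power2_abs power_mono)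
    then show False using ij(3) by (simp add: power_divide)
  qed
  then obtain a b where ab: "a \<in> {1..n}" "b \<in> {1..n}" "a \<noteq> b" "\<bar>\<phi> a - \<phi> b - 1\<bar> < 1 / 10 ^ 4"
  proof (cases "v = 1")
    case True
    then show ?thesis using that[of i j] v ij \<open>i \<noteq> j\<close> by simp
  next
    case False
    then have "v = - 1" using v \<open>v \<noteq> 0\<close> by simp
    then have "\<bar>\<phi> j - \<phi> i - 1\<bar> < 1 / 10 ^ 4" using v(2) unfolding abs_less_iff by simp
    then show ?thesis using that[of j i] ij \<open>i \<noteq> j\<close> by simp
  qed
  have "\<bar>\<phi> a - \<phi> l - 1\<bar> < 1 / 10 ^ 4" if l: "l \<in> {1..n}" "l \<noteq> a" for l
  proof (cases "l = b")
    case False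
    obtain v :: real where v: "v \<in> {-1, 0, 1}" "\<bar>\<phi> a - \<phi> l - v\<bar> < 1 / 10 ^ 4"
      by (rule coefficients_near_integer[of a l]) (use ab l in auto)
    obtain w :: real where w: "w \<in> {-1, 0, 1}" "\<bar>\<phi> l - \<phi> b - w\<bar> < 1 / 10 ^ 4"
      by (rule coefficients_near_integer[of l b]) (use ab l False in auto)
    have "v = 1 \<or> w = 1" using v w ab(4) unfolding abs_less_iff by auto
    then show ?thesis
    proof
      assume "w = 1"
      then show ?thesis using not_two_high[of a l b] ab l False w by auto
    qed (use v in simp)
  qed (use ab in simp)
  then show ?thesis using that ab(1) by blast
qed

text \<open>Each missing set of the star avoids \<open>n - k\<close> points, and for each
  \<open>j\<close> at most \<open>3 * c * N\<close> missing sets avoid \<open>j\<close>. Since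
  \<open>n - 1\<close> is at most \<open>2 * (n - k)\<close>, double counting gives
  \<open>6 * c * N\<close> for the missing sets. The family is no larger than the star, so no more
  sets lie outside than are missing inside.\<close>

theorem near_star: "\<exists>i\<in>{1..n}. real (card (\<A> - star n k i)) \<le> 6 * (c * N)"
proof -
  obtain i where i: "i \<in> {1..n}" "\<And>j. j \<in> {1..n} \<Longrightarrow> j \<noteq> i \<Longrightarrow> \<bar>\<phi> i - \<phi> j - 1\<bar> < 1 / 10 ^ 4"
    using high_point by blast
  define M where "M = star n k i - \<A>"
  define V where "V = {1..n} - {i}"
  have V: "finite V" "card V = n - 1" using i by (auto simp: V_def)
  have finS: "finite (star n k i)" by (simp add: star_def finite_imp_finite_nsets)
  then have finM: "finite M" by (simp add: M_def)
  have "(n - k) * card M = (\<Sum>A\<in>M. card {j \<in> V. j \<notin> A})"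
  proof -
    have "card {j \<in> V. j \<notin> A} = n - k" if "A \<in> M" for A
    proof -
      have A: "A \<subseteq> {1..n}" "finite A" "card A = k" "i \<in> A" using that by (auto simp: M_def star_def nsets_def)
      then have "{j \<in> V. j \<notin> A} = {1..n} - A" by (auto simp: V_def)
      then show ?thesis using A by (simp add: card_Diff_subset)
    qed
    then show ?thesis by simp
  qed
  also have "\<dots> = (\<Sum>j\<in>V. card {A \<in> M. j \<notin> A})"
    using sum.swap_restrict[OF finM V(1), of "\<lambda>_ _. 1::nat" "\<lambda>A j. j \<notin> A"] by simp
  finally have "real ((n - k) * card M) = real (\<Sum>j\<in>V. card {A \<in> M. j \<notin> A})" by (rule arg_cong)
  then have "real (n - k) * real (card M) = (\<Sum>j\<in>V. real (card {A \<in> M. j \<notin> A}))"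
    by (simp only: of_nat_mult of_nat_sum)
  also have "\<dots> \<le> (\<Sum>j\<in>V. 3 * (c * N))"
  proof (rule sum_mono)
    fix j assume j: "j \<in> V"
    have "{A \<in> M. j \<notin> A} = {A \<in> nsets {1..n} k. i \<in> A \<and> j \<notin> A \<and> A \<notin> \<A>}" by (auto simp: M_def star_def)
    then show "real (card {A \<in> M. j \<notin> A}) \<le> 3 * (c * N)" using card_missing_le[OF i(1) _ i(2)] j by (simp add: V_def)
  qed
  also have "\<dots> = real (n - 1) * (3 * (c * N))" using V by simp
  also have "\<dots> \<le> (2 * real (n - k)) * (3 * (c * N))"
    using k c N_pos by (intro mult_right_mono) auto
  also have "\<dots> = real (n - k) * (6 * (c * N))" by simp
  finally have M: "real (card M) \<le> 6 * (c * N)" using k by simp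
  have cS: "card (star n k i) = (n - 1) choose (k - 1)"
    using card_containing_avoiding[of i "{}"] i by (simp add: star_def)
  have "card (\<A> - star n k i) + card (\<A> \<inter> star n k i) = card \<A>"
    using finite_A by (metis add.commute card_Int_Diff)
  moreover have "card M + card (\<A> \<inter> star n k i) = card (star n k i)"
    using finS by (metis M_def add.commute card_Int_Diff inf_commute)
  ultimately have "card (\<A> - star n k i) \<le> card M" using card_le cS by linarith
  then have "real (card (\<A> - star n k i)) \<le> 6 * (c * N)" using M by linarith
  then show ?thesis using i(1) by blast
qed

end

section \<open>From the size hypothesis to the theorem\<close>

lemma card_star: "i \<in> {1..n} \<Longrightarrow> 0 < k \<Longrightarrow> card (star n k i) = (n - 1) choose (k - 1)"
  using card_nsets_superset[of "{1..n}" "{i}" k] by (simp add: star_def)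

text \<open>The hypothesis bounds the deficit by a multiple of \<open>n - 2k\<close>, the very
  factor on the left of \<open>intersecting_near_affine\<close>; it cancels and leaves a squared
  error of at most \<open>c * a\<close>.\<close>

theorem stability:
  fixes n k :: nat and c :: real
  assumes k: "0 < k" "2 * k < n" and A: "\<A> \<subseteq> nsets {1..n} k" "intersecting \<A>"
    and c: "0 \<le> c" "c \<le> 1 / 10 ^ 12"
    and large: "(1 - c * (real n - 2 * real k) / real n) * real ((n - 1) choose (k - 1)) \<le> real (card \<A>)"
  shows "\<exists>i\<in>{1..n}. real (card (\<A> - star n k i)) \<le> 6 * (c * real ((n - 1) choose (k - 1)))"
proof -
  define N where "N = real ((n - 1) choose (k - 1))"
  define a where "a = real (card \<A>)"
  define \<delta> where "\<delta> = real n - 2 * real k"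
  have N: "0 < N" using k by (simp add: N_def)
  have \<delta>: "0 < \<delta>" "\<delta> \<le> real n" using k by (auto simp: \<delta>_def)
  have a0: "0 < a"
  proof -
    have "c * \<delta> \<le> 1 / 10 ^ 12 * real n" using c \<delta> by (intro mult_mono) auto
    then have "c * \<delta> / real n < 1" using k by (simp add: field_simps)
    then have "0 < (1 - c * \<delta> / real n) * N" using N by simp
    then show ?thesis using large by (simp add: a_def N_def \<delta>_def)
  qed
  then have "\<A> \<noteq> {}" by (auto simp: a_def)
  obtain m \<phi> where "(\<Sum>A\<in>nsets {1..n} k. (of_bool (A \<in> \<A>) - m - (\<Sum>i\<in>A. \<phi> i))\<^sup>2) * (real (card {1..n}) - 2 * real k) *
      real ((card {1..n} - 1) choose (k - 1)) \<le>
      (real (card {1..n}) - real k - 1) * real (card \<A>) * (real ((card {1..n} - 1) choose (k - 1)) - real (card \<A>))"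
    by (rule intersecting_near_affine[of "{1..n}" k \<A>]) (use k A in \<open>auto simp: intersecting_def\<close>)
  then have aff: "(\<Sum>A\<in>nsets {1..n} k. (of_bool (A \<in> \<A>) - m - (\<Sum>i\<in>A. \<phi> i))\<^sup>2) * \<delta> * N \<le> (real n - real k - 1) * a * (N - a)"
    (is "?W * _ * _ \<le> _") by (simp add: \<delta>_def N_def a_def)
  have W0: "0 \<le> ?W" by (simp add: sum_nonneg)
  have nk: "0 < real n - real k - 1" "real n - real k - 1 \<le> real n" using k by auto
  \<comment> \<open>Nonnegativity of the squared error yields the Erdos-Ko-Rado bound, which
    \<open>near_affine\<close> takes as an assumption.\<close>
  have "0 \<le> ?W * \<delta> * N" using W0 \<delta> N by simp
  then have "0 \<le> ((real n - real k - 1) * a) * (N - a)" using aff by simp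
  then have "((real n - real k - 1) * a) * 0 \<le> ((real n - real k - 1) * a) * (N - a)" by simp
  then have "0 \<le> N - a" by (rule mult_left_le_imp_le) (use nk a0 in simp)
  then have aN: "a \<le> N" by simp
  have "real n * (N - a) \<le> c * \<delta> * N" using large k by (simp add: a_def N_def \<delta>_def field_simps)
  have "?W * \<delta> * N \<le> (real n - real k - 1) * a * (N - a)" by (rule aff)
  also have "\<dots> = a * ((real n - real k - 1) * (N - a))" by simp
  also have "\<dots> \<le> a * (real n * (N - a))" using nk a0 aN by (intro mult_left_mono mult_right_mono) auto
  also have "\<dots> \<le> a * (c * \<delta> * N)" using \<open>real n * (N - a) \<le> c * \<delta> * N\<close> a0 by (intro mult_left_mono) auto
  finally have "?W * (\<delta> * N) \<le> (c * a) * (\<delta> * N)" by (simp add: mult_ac)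
  then have "?W \<le> c * a" using \<delta> N by simp
  then interpret near_affine n k \<A> m c \<phi>
    by unfold_locales (use k A \<open>\<A> \<noteq> {}\<close> c aN in \<open>auto simp: a_def N_def\<close>)
  show ?thesis by (rule near_star)
qed

theorem theorem1p4:
  fixes n k :: nat and \<theta> c :: real and \<A> :: "nat set set"
  assumes "0 < \<theta>" and "\<theta> < 1 / 4"
    and "c = \<theta> / 10 ^ 12"
    and "0 < n" and "0 < k" and "2 * k < n"
    and "\<A> \<subseteq> nsets {1..n} k"
    and "intersecting \<A>"
    and "real (card \<A>) \<ge>
      (1 - c * (real n - 2 * real k) / real n) * real ((n - 1) choose (k - 1))"
  shows "\<exists>i\<in>{1..n}. let S = star n k i; E = card (\<A> - S) in
    real E \<le> 2 * \<theta> * real (card S) \<and>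
    card \<A> \<le> card (F_family n k E) \<and>
    (\<forall>u::real. real n - real k - 2 < u \<and> u \<le> real n - 2 \<and>
        real E = u gchoose (n - k - 1) \<longrightarrow>
      real (card \<A>) \<le> real ((n - 1) choose (k - 1)) - (u gchoose (k - 1)) + real E)"
proof -
  define C where "C = (n - 1) choose (k - 1)"
  have c: "0 \<le> c" "c \<le> 1 / 10 ^ 12" using assms(1-3) by (simp_all add: field_simps)
  obtain i where i: "i \<in> {1..n}" "real (card (\<A> - star n k i)) \<le> 6 * (c * real C)"
    using stability[OF assms(5,6,7,8) c assms(9)] unfolding C_def by blast
  have "6 * c \<le> 2 * \<theta>" using assms(1,3) by simp
  then have "6 * c * real C \<le> 2 * \<theta> * real C" by (rule mult_right_mono) simp
  then have E: "real (card (\<A> - star n k i)) \<le> 2 * \<theta> * real (card (star n k i))"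
    using i card_star[OF i(1) assms(5)] by (simp add: C_def)
  show ?thesis
    unfolding Let_def
    using i(1) E card_intersecting_le_F_family[OF i(1) assms(5-8)]
      card_intersecting_le_gbinomial[OF i(1) assms(5-8)] by blast
qed

end
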